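(* Let $X$ be the log-price $X_t = x-\frac12\int_0^t\sigma_s^2\,ds+\int_0^t\sigma_s\,dZ_s$ of an asset $S=e^{X}$, with $\sigma$ and $Z$ as described in the context. Let $B^{\ast}>S_0=e^x$ be the barrier, $b=\log B^{\ast}$, and let $K>0$ be the strike price. For $T\in(0,1]$ let $$C_0^b = C_0^b(T)=\mathbb{E}\left[(S_T-K)_+\,\mathbf{1}_{\{\sup_{t\in[0,T]}S_t\ge B^{\ast}\}}\right].$$ Then: (i) $\lim_{T\to0}C_0^b=0$. (ii) There exist $T_0>0$ and constants $c_1,c_2,c_3>0$ (not depending on $T$) such that for all $T\le T_0$ $$\mathbb{P}\left(\sup_{t\in[0,T]}S_t\ge B^{\ast}\right)\le\min\left\{\exp\left(-\frac{(b-x)^2}{c_1T}\right),\ \int_b^\infty\frac{c_2}{\sqrt T}\exp\left(-\frac{(z-x)^2}{2c_3T}\right)dz\right\}.$$ In particular, $C_0^b=o(T^{m})$ as $T\to0$ for every $m>0$.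
   Context: Setting. $W$ and $B$ are independent standard Brownian motions on a probability space, with time parameter in $[0,1]$; $\rho\in(-1,1)$; $Z=\rho W+\sqrt{1-\rho^2}\,B$; $x\in\mathbb{R}$. The volatility $\sigma=(\sigma_t)_{t\in[0,1]}$ is a square-integrable process adapted to the filtration generated by $W$, such that: (H1) there are constants $0<\alpha<\beta$ with $\alpha\le\sigma_t\le\beta$ almost surely for almost every $t$; (H2) for all $p\ge2$, $\sigma\in\mathbb{L}^{1,p}_W:=L^p([0,1];\mathbb{D}^{1,p}_W)$, where $\mathbb{D}^{1,p}_W$ is the Malliavin–Sobolev space with respect to $W$. The process $X$ is taken with continuous paths. The maturity $T$ ranges in $(0,1]$. *)

theory Defs
  imports "HOL-Probability.Probability"
begin

definition std_brownian_motion :: "'a measure \<Rightarrow> (real \<Rightarrow> 'a \<Rightarrow> real) \<Rightarrow> bool" where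
  "std_brownian_motion M W \<longleftrightarrow>
     (\<forall>t\<in>{0..1}. W t \<in> borel_measurable M) \<and>
     (AE \<omega> in M. W 0 \<omega> = 0) \<and>
     (\<forall>s t. 0 \<le> s \<and> s < t \<and> t \<le> 1 \<longrightarrow>
        distributed M lborel (\<lambda>\<omega>. W t \<omega> - W s \<omega>)
          (\<lambda>y. ennreal (normal_density 0 (sqrt (t - s)) y))) \<and>
     (\<forall>(n::nat) \<tau>. 0 \<le> \<tau> 0 \<and> (\<forall>i<n. \<tau> i \<le> \<tau> (Suc i)) \<and> \<tau> n \<le> 1 \<longrightarrow>
        prob_space.indep_vars M (\<lambda>_. borel) (\<lambda>i \<omega>. W (\<tau> (Suc i)) \<omega> - W (\<tau> i) \<omega>) {..<n}) \<and>
     (AE \<omega> in M. continuous_on {0..1} (\<lambda>t. W t \<omega>))"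

definition indep_processes ::
    "'a measure \<Rightarrow> (real \<Rightarrow> 'a \<Rightarrow> real) \<Rightarrow> (real \<Rightarrow> 'a \<Rightarrow> real) \<Rightarrow> bool" where
  "indep_processes M W B \<longleftrightarrow>
     prob_space.indep_var M
       (Pi\<^sub>M {0..1} (\<lambda>_. borel)) (\<lambda>\<omega>. \<lambda>t\<in>{0..1}. W t \<omega>)
       (Pi\<^sub>M {0..1} (\<lambda>_. borel)) (\<lambda>\<omega>. \<lambda>t\<in>{0..1}. B t \<omega>)"

text \<open>The filtration generated by a process, augmented as usual by the null sets of the measure.
  The state space is generic so that the joint filtration of two real processes is the one
  generated by the pair.\<close>

definition generated_filtration ::
    "'a measure \<Rightarrow> (real \<Rightarrow> 'a \<Rightarrow> 'b::topological_space) \<Rightarrow> real \<Rightarrow> 'a measure" where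
  "generated_filtration M X t =
     sigma (space M) ({X s -` A \<inter> space M | s A. s \<in> {0..t} \<and> A \<in> sets borel} \<union> null_sets M)"

definition jointly_measurable :: "'a measure \<Rightarrow> (real \<Rightarrow> 'a \<Rightarrow> real) \<Rightarrow> bool" where
  "jointly_measurable M H \<longleftrightarrow>
     (\<lambda>(t, \<omega>). H t \<omega>) \<in> borel_measurable (restrict_space borel {0..1} \<Otimes>\<^sub>M M)"

definition square_integrable_process :: "'a measure \<Rightarrow> (real \<Rightarrow> 'a \<Rightarrow> real) \<Rightarrow> bool" where
  "square_integrable_process M H \<longleftrightarrow> jointly_measurable M H \<and>
     (\<integral>\<^sup>+\<omega>. (\<integral>\<^sup>+t\<in>{0..1}. ennreal ((H t \<omega>)\<^sup>2) \<partial>lborel) \<partial>M) < \<infinity>"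

text \<open>The triple \<open>(n, \<tau>, \<xi>)\<close> stands for the simple process
  \<open>\<Sum>i<n. \<xi> i * 1_(\<tau> i, \<tau> (i+1)]\<close>.\<close>

definition simple_integrand ::
    "'a measure \<Rightarrow> (real \<Rightarrow> 'a measure) \<Rightarrow> nat \<Rightarrow> (nat \<Rightarrow> real) \<Rightarrow> (nat \<Rightarrow> 'a \<Rightarrow> real) \<Rightarrow> bool" where
  "simple_integrand M F n \<tau> \<xi> \<longleftrightarrow>
     0 \<le> \<tau> 0 \<and> (\<forall>i<n. \<tau> i \<le> \<tau> (Suc i)) \<and> \<tau> n \<le> 1 \<and>
     (\<forall>i<n. \<xi> i \<in> borel_measurable (F (\<tau> i))) \<and>
     (\<exists>C. \<forall>i<n. \<forall>\<omega>\<in>space M. \<bar>\<xi> i \<omega>\<bar> \<le> C)"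

definition simple_value :: "nat \<Rightarrow> (nat \<Rightarrow> real) \<Rightarrow> (nat \<Rightarrow> 'a \<Rightarrow> real) \<Rightarrow> real \<Rightarrow> 'a \<Rightarrow> real" where
  "simple_value n \<tau> \<xi> t \<omega> = (\<Sum>i<n. \<xi> i \<omega> * indicator {\<tau> i<..\<tau> (Suc i)} t)"

definition simple_integral ::
    "(real \<Rightarrow> 'a \<Rightarrow> real) \<Rightarrow> nat \<Rightarrow> (nat \<Rightarrow> real) \<Rightarrow> (nat \<Rightarrow> 'a \<Rightarrow> real) \<Rightarrow> real \<Rightarrow> 'a \<Rightarrow> real" where
  "simple_integral Z n \<tau> \<xi> t \<omega> =
     (\<Sum>i<n. \<xi> i \<omega> * (Z (min (\<tau> (Suc i)) t) \<omega> - Z (min (\<tau> i) t) \<omega>))"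

text \<open>\<open>I t\<close> is a version of the integral of \<open>H\<close> with respect to \<open>Z\<close> over \<open>[0,t]\<close>, for each \<open>t\<close> in
  \<open>[0,1]\<close>: the mean-square limit of the integrals of simple processes converging to \<open>H\<close> in
  \<open>L\<^sup>2([0,1] \<times> \<Omega>)\<close>. By the Ito isometry the choice of the approximating sequence is irrelevant when
  \<open>Z\<close> is a Brownian motion for \<open>F\<close>. No path regularity of \<open>I\<close> is required.\<close>

definition has_ito_integral ::
    "'a measure \<Rightarrow> (real \<Rightarrow> 'a measure) \<Rightarrow> (real \<Rightarrow> 'a \<Rightarrow> real) \<Rightarrow> (real \<Rightarrow> 'a \<Rightarrow> real) \<Rightarrow>
     (real \<Rightarrow> 'a \<Rightarrow> real) \<Rightarrow> bool" where
  "has_ito_integral M F Z H I \<longleftrightarrow>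
     (\<forall>t\<in>{0..1}. I t \<in> borel_measurable M) \<and>
     (\<exists>n \<tau> \<xi>. (\<forall>k::nat. simple_integrand M F (n k) (\<tau> k) (\<xi> k)) \<and>
        (\<lambda>k. \<integral>\<^sup>+\<omega>. (\<integral>\<^sup>+t\<in>{0..1}.
           ennreal ((simple_value (n k) (\<tau> k) (\<xi> k) t \<omega> - H t \<omega>)\<^sup>2) \<partial>lborel) \<partial>M) \<longlonglongrightarrow> 0 \<and>
        (\<forall>t\<in>{0..1}. (\<lambda>k. \<integral>\<^sup>+\<omega>.
           ennreal ((simple_integral Z (n k) (\<tau> k) (\<xi> k) t \<omega> - I t \<omega>)\<^sup>2) \<partial>M) \<longlonglongrightarrow> 0))"

definition wiener_integral ::
    "'a measure \<Rightarrow> (real \<Rightarrow> 'a \<Rightarrow> real) \<Rightarrow> (real \<Rightarrow> real) \<Rightarrow> ('a \<Rightarrow> real) \<Rightarrow> bool" where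
  "wiener_integral M W h Y \<longleftrightarrow>
     (\<exists>I. has_ito_integral M (generated_filtration M W) W (\<lambda>t _. h t) I \<and> Y = I 1)"

definition partial_deriv :: "nat \<Rightarrow> ((nat \<Rightarrow> real) \<Rightarrow> real) \<Rightarrow> (nat \<Rightarrow> real) \<Rightarrow> real" where
  "partial_deriv i f y = deriv (\<lambda>u. f (y(i := u))) (y i)"

text \<open>Smooth functions on \<open>\<real>\<^sup>n\<close>, bounded together with all partial derivatives. Since the dimension
  varies, points of \<open>\<real>\<^sup>n\<close> are sequences of which only the entries below \<open>n\<close> matter.\<close>

definition Cb_infty :: "nat \<Rightarrow> ((nat \<Rightarrow> real) \<Rightarrow> real) \<Rightarrow> bool" where
  "Cb_infty n f \<longleftrightarrow>
     (\<forall>y y'. (\<forall>i<n. y i = y' i) \<longrightarrow> f y = f y') \<and>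
     (\<forall>is. set is \<subseteq> {..<n} \<longrightarrow>
        (let g = foldr partial_deriv is f in
           continuous_on UNIV g \<and> bounded (range g) \<and>
           (\<forall>i<n. \<forall>y. (\<lambda>u. g (y(i := u))) differentiable (at (y i)))))"

text \<open>\<open>F = f(W(h\<^sub>0),\<dots>,W(h\<^sub>n\<^sub>-\<^sub>1))\<close>, with Malliavin derivative
  \<open>D\<^sub>s F = \<Sum>i<n. \<partial>\<^sub>i f(W(h\<^sub>0),\<dots>,W(h\<^sub>n\<^sub>-\<^sub>1)) h\<^sub>i(s)\<close>.\<close>

definition smooth_functional ::
    "'a measure \<Rightarrow> (real \<Rightarrow> 'a \<Rightarrow> real) \<Rightarrow> ('a \<Rightarrow> real) \<Rightarrow> (real \<Rightarrow> 'a \<Rightarrow> real) \<Rightarrow> bool" where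
  "smooth_functional M W F D \<longleftrightarrow>
     (\<exists>n f h Y. Cb_infty n f \<and>
        (\<forall>i<n. h i \<in> borel_measurable borel \<and>
               set_integrable lborel {0..1} (\<lambda>s. (h i s)\<^sup>2) \<and>
               wiener_integral M W (h i) (Y i)) \<and>
        F = (\<lambda>\<omega>. f (\<lambda>i. Y i \<omega>)) \<and>
        D = (\<lambda>s \<omega>. \<Sum>i<n. partial_deriv i f (\<lambda>j. Y j \<omega>) * h i s))"

definition ennreal_powr :: "ennreal \<Rightarrow> real \<Rightarrow> ennreal" where
  "ennreal_powr a p = (if a = \<infinity> then \<infinity> else ennreal (enn2real a powr p))"

text \<open>\<open>E|F|\<^sup>p + E\<parallel>D\<parallel>\<^sup>p\<close>, where \<open>\<parallel>D\<parallel>\<close> is the norm of \<open>L\<^sup>2([0,1])\<close>.\<close>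

definition graph_norm_pow ::
    "'a measure \<Rightarrow> real \<Rightarrow> ('a \<Rightarrow> real) \<Rightarrow> (real \<Rightarrow> 'a \<Rightarrow> real) \<Rightarrow> ennreal" where
  "graph_norm_pow M p F D =
     (\<integral>\<^sup>+\<omega>. ennreal (\<bar>F \<omega>\<bar> powr p) \<partial>M) +
     (\<integral>\<^sup>+\<omega>. ennreal_powr (\<integral>\<^sup>+s\<in>{0..1}. ennreal ((D s \<omega>)\<^sup>2) \<partial>lborel) (p / 2) \<partial>M)"

text \<open>\<open>(F, D)\<close> belongs to the closure, in \<open>L\<^sup>p(\<Omega>) \<times> L\<^sup>p(\<Omega>; L\<^sup>2([0,1]))\<close>, of the graph of the
  derivative operator on smooth functionals. The operator is closable, so \<open>D\<close> is determined by \<open>F\<close>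
  up to null sets.\<close>

definition has_malliavin_derivative ::
    "'a measure \<Rightarrow> (real \<Rightarrow> 'a \<Rightarrow> real) \<Rightarrow> real \<Rightarrow> ('a \<Rightarrow> real) \<Rightarrow> (real \<Rightarrow> 'a \<Rightarrow> real) \<Rightarrow> bool" where
  "has_malliavin_derivative M W p F D \<longleftrightarrow>
     F \<in> borel_measurable M \<and> jointly_measurable M D \<and>
     (\<exists>Fs Ds. (\<forall>k::nat. smooth_functional M W (Fs k) (Ds k)) \<and>
        (\<lambda>k. graph_norm_pow M p (\<lambda>\<omega>. Fs k \<omega> - F \<omega>) (\<lambda>s \<omega>. Ds k s \<omega> - D s \<omega>)) \<longlonglongrightarrow> 0)"

definition sobolev_D1 ::
    "'a measure \<Rightarrow> (real \<Rightarrow> 'a \<Rightarrow> real) \<Rightarrow> real \<Rightarrow> ('a \<Rightarrow> real) set" where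
  "sobolev_D1 M W p = {F. \<exists>D. has_malliavin_derivative M W p F D}"

definition malliavin_derivative ::
    "'a measure \<Rightarrow> (real \<Rightarrow> 'a \<Rightarrow> real) \<Rightarrow> real \<Rightarrow> ('a \<Rightarrow> real) \<Rightarrow> real \<Rightarrow> 'a \<Rightarrow> real" where
  "malliavin_derivative M W p F = (SOME D. has_malliavin_derivative M W p F D)"

text \<open>The \<open>p\<close>-th power of the norm of \<open>sobolev_D1 M W p\<close>, meant for members of that space.\<close>

definition sobolev_norm_pow ::
    "'a measure \<Rightarrow> (real \<Rightarrow> 'a \<Rightarrow> real) \<Rightarrow> real \<Rightarrow> ('a \<Rightarrow> real) \<Rightarrow> ennreal" where
  "sobolev_norm_pow M W p F = graph_norm_pow M p F (malliavin_derivative M W p F)"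

text \<open>The Bochner space \<open>L\<^sup>p([0,1]; D\<^sup>1\<^sup>,\<^sup>p)\<close>: the map \<open>t \<mapsto> u t\<close> is almost everywhere the limit of
  simple functions with values in \<open>D\<^sup>1\<^sup>,\<^sup>p\<close>, and its norm is \<open>p\<close>-integrable. The
  distribution's Bochner integration is not applicable since \<open>D\<^sup>1\<^sup>,\<^sup>p\<close> is not a type.\<close>

definition sobolev_L1 ::
    "'a measure \<Rightarrow> (real \<Rightarrow> 'a \<Rightarrow> real) \<Rightarrow> real \<Rightarrow> (real \<Rightarrow> 'a \<Rightarrow> real) set" where
  "sobolev_L1 M W p = {u.
     (AE t in lborel. t \<in> {0..1} \<longrightarrow> u t \<in> sobolev_D1 M W p) \<and>
     (\<exists>n A G. (\<forall>k::nat. \<forall>i<(n k::nat). A k i \<in> sets borel \<and> G k i \<in> sobolev_D1 M W p) \<and>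
        (AE t in lborel. t \<in> {0..1} \<longrightarrow>
           (\<lambda>k. sobolev_norm_pow M W p
                  (\<lambda>\<omega>. (\<Sum>i<n k. indicator (A k i) t * G k i \<omega>) - u t \<omega>)) \<longlonglongrightarrow> 0)) \<and>
     (\<integral>\<^sup>+t\<in>{0..1}. sobolev_norm_pow M W p (u t) \<partial>lborel) < \<infinity>}"

definition barrier_event :: "'a measure \<Rightarrow> (real \<Rightarrow> 'a \<Rightarrow> real) \<Rightarrow> real \<Rightarrow> real \<Rightarrow> 'a set" where
  "barrier_event M S Bstar T = {\<omega> \<in> space M. (SUP t\<in>{0..T}. S t \<omega>) \<ge> Bstar}"

definition barrier_call_price ::
    "'a measure \<Rightarrow> (real \<Rightarrow> 'a \<Rightarrow> real) \<Rightarrow> real \<Rightarrow> real \<Rightarrow> real \<Rightarrow> real" where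
  "barrier_call_price M S K Bstar T =
     (\<integral>\<omega>. max 0 (S T \<omega> - K) * indicator (barrier_event M S Bstar T) \<omega> \<partial>M)"

end

theory Submission
  imports Defs "HOL-Real_Asymp.Real_Asymp"
begin

text \<open>For a simple integrand \<open>H\<close> the process \<open>exp (\<theta> \<integral>H dZ - \<theta>\<^sup>2/2 \<integral>H\<^sup>2 dt)\<close> is a martingale with mean 1,
  so Doob's inequality bounds its maximum over a finite time grid. The bound survives the mean-square
  limit that defines the stochastic integral \<open>J\<close> of \<open>\<sigma>\<close>: as \<open>\<bar>\<sigma>\<bar> \<le> \<beta>\<close>, the bracket of an approximating
  integrand \<open>H\<close> is at most \<open>2 \<beta>\<^sup>2 t + 2 \<integral>(H - \<sigma>)\<^sup>2 dt\<close>, whose last term tends to 0 in mean. This gives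
  \<open>P (max J > d) \<le> exp (- \<theta> d + \<theta>\<^sup>2 \<beta>\<^sup>2 T)\<close> on every finite grid in \<open>[0,T]\<close>, with a constant that is not
  sharp. Since \<open>X \<le> x + J\<close>, optimizing over \<open>\<theta>\<close> and passing to dyadic grids yields a Gaussian tail for
  the running maximum of \<open>X\<close>. For the price, \<open>E[S 1\<^sub>A] \<le> L P(A) + E[S\<^sup>2] / L\<close> with \<open>L\<close> the inverse square
  root of the tail bound.\<close>

section \<open>Brownian increments and the generated filtration\<close>

text \<open>The definition of Brownian motion supplies independence only of consecutive increments
  of one process along one grid, whereas the stochastic integral admits integrands measurable for
  the augmented filtration of the pair (W, B). A pi-system argument bridges the two; conditional
  expectations are then avoided by testing the martingale property on sets of the past. The second
  obstacle is that J is known only at fixed times, without path regularity, so its supremum over an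
  interval is out of reach. The maximal inequality therefore lives on finite grids, with a bound
  independent of the number of points, and path continuity enters only through X. Grid points near
  the maximizer of X may still lie below b, so a lower level is tested, half way between x and b.
  This explains the constant 16 \<beta>^2: the minimum over \<theta> of -\<theta> d + \<theta>^2
  \<beta>^2 T is -d^2 / (4 \<beta>^2 T), with d = (b - x) / 2. The Gaussian integral in the second
  bound dominates the exponential bound once c2 is large enough, so only the exponential bound is
  probabilistic.\<close>

lemma (in prob_space) nn_integral_indep_pair:
  assumes X[measurable]: "X \<in> measurable M S" and Y[measurable]: "Y \<in> measurable M T"
    and ind: "\<And>A C. A \<in> sets S \<Longrightarrow> C \<in> sets T \<Longrightarrow>
      prob {\<omega> \<in> space M. X \<omega> \<in> A \<and> Y \<omega> \<in> C} = prob {\<omega> \<in> space M. X \<omega> \<in> A} * prob {\<omega> \<in> space M. Y \<omega> \<in> C}"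
    and f[measurable]: "f \<in> borel_measurable (S \<Otimes>\<^sub>M T)"
  shows "(\<integral>\<^sup>+\<omega>. f (X \<omega>, Y \<omega>) \<partial>M) = (\<integral>\<^sup>+\<omega>. \<integral>\<^sup>+\<omega>'. f (X \<omega>, Y \<omega>') \<partial>M \<partial>M)"
proof -
  interpret X: prob_space "distr M S X" by (rule prob_space_distr) simp
  interpret Y: prob_space "distr M T Y" by (rule prob_space_distr) simp
  have eq: "distr M S X \<Otimes>\<^sub>M distr M T Y = distr M (S \<Otimes>\<^sub>M T) (\<lambda>\<omega>. (X \<omega>, Y \<omega>))"
  proof (rule pair_measure_eqI)
    fix A C assume "A \<in> sets (distr M S X)" "C \<in> sets (distr M T Y)"
    moreover have eqs: "(\<lambda>\<omega>. (X \<omega>, Y \<omega>)) -` (A \<times> C) \<inter> space M = {\<omega> \<in> space M. X \<omega> \<in> A \<and> Y \<omega> \<in> C}"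
      "X -` A \<inter> space M = {\<omega> \<in> space M. X \<omega> \<in> A}" "Y -` C \<inter> space M = {\<omega> \<in> space M. Y \<omega> \<in> C}"
      by auto
    ultimately have [measurable]: "A \<in> sets S" "C \<in> sets T" by simp_all
    note ind = ind[OF this, folded eqs]
    show "emeasure (distr M S X) A * emeasure (distr M T Y) C =
        emeasure (distr M (S \<Otimes>\<^sub>M T) (\<lambda>\<omega>. (X \<omega>, Y \<omega>))) (A \<times> C)"
      by (subst (1 2 3) emeasure_distr) (simp_all add: emeasure_eq_measure ind ennreal_mult)
  qed (simp_all add: X.sigma_finite_measure_axioms Y.sigma_finite_measure_axioms)
  have "(\<integral>\<^sup>+\<omega>. f (X \<omega>, Y \<omega>) \<partial>M) = integral\<^sup>N (distr M (S \<Otimes>\<^sub>M T) (\<lambda>\<omega>. (X \<omega>, Y \<omega>))) f"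
    by (subst nn_integral_distr) simp_all
  also have "\<dots> = (\<integral>\<^sup>+a. \<integral>\<^sup>+b. f (a, b) \<partial>distr M T Y \<partial>distr M S X)"
    unfolding eq[symmetric] by (subst Y.nn_integral_fst[symmetric]) simp_all
  also have "\<dots> = (\<integral>\<^sup>+\<omega>. \<integral>\<^sup>+\<omega>'. f (X \<omega>, Y \<omega>') \<partial>M \<partial>M)"
    by (subst nn_integral_distr) (auto simp: nn_integral_distr intro!: nn_integral_cong)
  finally show ?thesis .
qed

text \<open>Completing the square: the tilted density is
  \<open>exp (l\<^sup>2 * s\<^sup>2 / 2)\<close> times the normal density with mean
  \<open>l * s\<^sup>2\<close>, which has mass 1.\<close>

lemma nn_integral_normal_density_exp:
  assumes "0 < s"
  shows "(\<integral>\<^sup>+x. ennreal (normal_density 0 s x) * ennreal (exp (l * x)) \<partial>lborel) = ennreal (exp (l\<^sup>2 * s\<^sup>2 / 2))"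
proof -
  have "ennreal (normal_density 0 s x) * ennreal (exp (l * x)) =
      ennreal (exp (l\<^sup>2 * s\<^sup>2 / 2)) * ennreal (normal_density (l * s\<^sup>2) s x)" for x
    using assms unfolding normal_density_def
    by (simp add: ennreal_mult[symmetric] exp_add[symmetric] field_simps power2_eq_square)
  then have "(\<integral>\<^sup>+x. ennreal (normal_density 0 s x) * ennreal (exp (l * x)) \<partial>lborel) =
      ennreal (exp (l\<^sup>2 * s\<^sup>2 / 2)) * (\<integral>\<^sup>+x. ennreal (normal_density (l * s\<^sup>2) s x) \<partial>lborel)"
    by (simp add: nn_integral_cmult)
  also have "(\<integral>\<^sup>+x. ennreal (normal_density (l * s\<^sup>2) s x) \<partial>lborel) = 1"
    using assms by (subst nn_integral_eq_integral) auto
  finally show ?thesis by simp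
qed

lemma (in prob_space) std_brownian_motion_mgf:
  assumes bm: "std_brownian_motion M W" and "0 \<le> s" "s \<le> t" "t \<le> 1"
  shows "(\<integral>\<^sup>+\<omega>. ennreal (exp (l * (W t \<omega> - W s \<omega>))) \<partial>M) = ennreal (exp (l\<^sup>2 * (t - s) / 2))"
\<comment> \<open>The law of an increment is prescribed for s < t only.\<close>
proof (cases "s = t")
  case True
  then show ?thesis by (simp add: emeasure_space_1)
next
  case False
  then have "distributed M lborel (\<lambda>\<omega>. W t \<omega> - W s \<omega>) (\<lambda>y. ennreal (normal_density 0 (sqrt (t - s)) y))"
    using assms by (auto simp: std_brownian_motion_def)
  then have "(\<integral>\<^sup>+\<omega>. ennreal (exp (l * (W t \<omega> - W s \<omega>))) \<partial>M) =
     (\<integral>\<^sup>+x. ennreal (normal_density 0 (sqrt (t - s)) x) * ennreal (exp (l * x)) \<partial>lborel)"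
    by (subst distributed_nn_integral) simp_all
  also have "\<dots> = ennreal (exp (l\<^sup>2 * (t - s) / 2))"
    using False assms by (subst nn_integral_normal_density_exp) auto
  finally show ?thesis .
qed

text \<open>Past values are partial sums of increments along a grid through 0, U, s and t, up to the
  null set where the path does not start at 0. A cylinder condition on the past thus concerns the
  increments before s, which are independent of the last one.\<close>

lemma (in prob_space) std_brownian_motion_cylinder_indep:
  assumes bm: "std_brownian_motion M W" and st: "0 \<le> s" "s < t" "t \<le> 1"
    and U: "finite U" "U \<subseteq> {0..s}" and A: "\<And>u. u \<in> U \<Longrightarrow> A u \<in> sets borel"
    and C[measurable]: "C \<in> sets borel"
  shows "prob {\<omega> \<in> space M. (\<forall>u\<in>U. W u \<omega> \<in> A u) \<and> W t \<omega> - W s \<omega> \<in> C} =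
    prob {\<omega> \<in> space M. \<forall>u\<in>U. W u \<omega> \<in> A u} * prob {\<omega> \<in> space M. W t \<omega> - W s \<omega> \<in> C}"
proof -
  \<comment> \<open>The grid may repeat a point, for example when 0 or s lies in U; the definition
    of Brownian motion only asks for a nondecreasing grid. Since \<open>xs ! n = s\<close>, the
    increments with index below n are the past and \<open>D n\<close> is the increment over
    [s, t].\<close>
  define xs where "xs = 0 # sorted_list_of_set U @ [s, t]"
  define n where "n = Suc (card U)"
  define D where "D i \<omega> = W (xs ! Suc i) \<omega> - W (xs ! i) \<omega>" for i \<omega>
  have len: "length xs = n + 2" by (simp add: xs_def n_def)
  have srt: "sorted xs"
    using U st by (auto simp: xs_def sorted_append subset_iff)
  have last: "xs ! n = s" "xs ! Suc n = t" by (simp_all add: xs_def n_def nth_append)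
  have [measurable]: "\<And>u. u \<in> U \<Longrightarrow> A u \<in> sets borel" by fact
  have W: "W u \<in> borel_measurable M" if "u \<in> {0..1}" for u
    using bm that by (auto simp: std_brownian_motion_def)
  have [measurable]: "W u \<in> borel_measurable M" if "u \<in> U" for u
    using U st that by (intro W) auto
  have [measurable]: "W t \<in> borel_measurable M" "W s \<in> borel_measurable M" using st by (auto intro: W)
  have indep: "indep_vars (\<lambda>_. borel) D {..<Suc n}"
    unfolding D_def
  proof (rule bm[unfolded std_brownian_motion_def, THEN conjunct2, THEN conjunct2, THEN conjunct2,
      THEN conjunct1, rule_format, of "\<lambda>i. xs ! i" "Suc n"], intro conjI allI impI)
    show "0 \<le> xs ! 0" by (simp add: xs_def)
    show "xs ! Suc n \<le> 1" using last st by simp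
    fix i assume "i < Suc n"
    then show "xs ! i \<le> xs ! Suc i" using srt len by (intro sorted_nth_mono) auto
  qed
  have "\<forall>u\<in>U. \<exists>j\<le>n. xs ! j = u"
  proof
    fix u assume "u \<in> U"
    then have "u \<in> set (sorted_list_of_set U)" using U by simp
    then obtain j where "j < card U" "sorted_list_of_set U ! j = u" by (auto simp: in_set_conv_nth)
    then show "\<exists>j\<le>n. xs ! j = u" by (intro exI[of _ "Suc j"]) (auto simp: xs_def n_def nth_append)
  qed
  then obtain idx where idx: "\<And>u. u \<in> U \<Longrightarrow> idx u \<le> n" "\<And>u. u \<in> U \<Longrightarrow> xs ! idx u = u" by metis
  have tele: "(\<Sum>i<j. D i \<omega>) = W (xs ! j) \<omega> - W 0 \<omega>" for j \<omega>
    unfolding D_def by (subst sum_lessThan_telescope) (simp add: xs_def)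
  define PA where "PA = {p \<in> space (PiM {..<n} (\<lambda>_. borel :: real measure)). \<forall>u\<in>U. (\<Sum>i<idx u. p i) \<in> A u}"
  define PB where "PB = {p \<in> space (PiM {n} (\<lambda>_. borel :: real measure)). p n \<in> C}"
  have sum_meas: "(\<lambda>p. \<Sum>i<idx u. p i) \<in> borel_measurable (PiM {..<n} (\<lambda>_. borel :: real measure))" if "u \<in> U" for u
    using idx(1)[OF that] by (intro borel_measurable_sum measurable_component_singleton) auto
  have PA: "PA \<in> sets (PiM {..<n} (\<lambda>_. borel))"
    unfolding PA_def
    using U(1) A sum_meas by (intro sets.sets_Collect_finite_All) (auto intro!: measurable_sets_Collect)
  have PB: "PB \<in> sets (PiM {n} (\<lambda>_. borel))" unfolding PB_def by measurable
  have "indep_var (PiM {..<n} (\<lambda>_. borel)) (\<lambda>\<omega>. \<lambda>i\<in>{..<n}. D i \<omega>) (PiM {n} (\<lambda>_. borel)) (\<lambda>\<omega>. \<lambda>i\<in>{n}. D i \<omega>)"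
    by (rule indep_var_restrict[OF indep]) auto
  note ind = this
  let ?X = "\<lambda>\<omega>. \<lambda>i\<in>{..<n}. D i \<omega>" and ?Y = "\<lambda>\<omega>. \<lambda>i\<in>{n}. D i \<omega>"
  note [measurable] = indep_var_rv1[OF ind] indep_var_rv2[OF ind] PA PB
  have Y_iff: "?Y \<omega> \<in> PB \<longleftrightarrow> W t \<omega> - W s \<omega> \<in> C" for \<omega>
    by (simp add: PB_def space_PiM D_def last)
  have X_iff: "?X \<omega> \<in> PA \<longleftrightarrow> (\<forall>u\<in>U. W u \<omega> \<in> A u)" if "W 0 \<omega> = 0" for \<omega>
  proof -
    have "(\<Sum>i<idx u. ?X \<omega> i) = W u \<omega>" if "u \<in> U" for u
    proof -
      have "(\<Sum>i<idx u. ?X \<omega> i) = (\<Sum>i<idx u. D i \<omega>)"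
        using idx(1)[OF that] by (intro sum.cong) auto
      then show ?thesis using \<open>W 0 \<omega> = 0\<close> idx(2)[OF that] by (simp add: tele)
    qed
    then show ?thesis by (simp add: PA_def space_PiM)
  qed
  have AE0: "AE \<omega> in M. W 0 \<omega> = 0" using bm by (auto simp: std_brownian_motion_def)
  have "prob {\<omega> \<in> space M. (\<forall>u\<in>U. W u \<omega> \<in> A u) \<and> W t \<omega> - W s \<omega> \<in> C} =
      prob ((\<lambda>\<omega>. (?X \<omega>, ?Y \<omega>)) -` (PA \<times> PB) \<inter> space M)"
    using AE0 U(1) by (intro finite_measure_eq_AE) (auto simp: X_iff Y_iff elim!: eventually_mono)
  also have "\<dots> = prob (?X -` PA \<inter> space M) * prob (?Y -` PB \<inter> space M)"
    by (rule indep_varD[OF ind PA PB])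
  also have "prob (?X -` PA \<inter> space M) = prob {\<omega> \<in> space M. \<forall>u\<in>U. W u \<omega> \<in> A u}"
    using AE0 U(1) by (intro finite_measure_eq_AE) (auto simp: X_iff elim!: eventually_mono)
  also have "?Y -` PB \<inter> space M = {\<omega> \<in> space M. W t \<omega> - W s \<omega> \<in> C}"
    by (auto simp: Y_iff)
  finally show ?thesis .
qed

lemma (in prob_space) indep_processesD:
  assumes "indep_processes M W B"
    and "P \<in> sets (Pi\<^sub>M {0..1} (\<lambda>_. borel))" "Q \<in> sets (Pi\<^sub>M {0..1} (\<lambda>_. borel))"
  shows "prob {\<omega> \<in> space M. restrict (\<lambda>t. W t \<omega>) {0..1} \<in> P \<and> restrict (\<lambda>t. B t \<omega>) {0..1} \<in> Q} =
     prob {\<omega> \<in> space M. restrict (\<lambda>t. W t \<omega>) {0..1} \<in> P} *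
     prob {\<omega> \<in> space M. restrict (\<lambda>t. B t \<omega>) {0..1} \<in> Q}"
proof -
  have *: "{\<omega> \<in> space M. f \<omega> \<in> R} = f -` R \<inter> space M" for f :: "'a \<Rightarrow> 'c" and R by auto
  have "{\<omega> \<in> space M. restrict (\<lambda>t. W t \<omega>) {0..1} \<in> P \<and> restrict (\<lambda>t. B t \<omega>) {0..1} \<in> Q} =
    (\<lambda>\<omega>. (restrict (\<lambda>t. W t \<omega>) {0..1}, restrict (\<lambda>t. B t \<omega>) {0..1})) -` (P \<times> Q) \<inter> space M" by auto
  then show ?thesis
    unfolding * using indep_varD[OF assms(1)[unfolded indep_processes_def] assms(2,3)] by simp
qed

lemma cylinder_increment_in_PiM:
  fixes A :: "real \<Rightarrow> real set"
  assumes "finite U" "U \<subseteq> {0..1}" "s \<in> {0..1}" "t \<in> {0..1}"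
    and A: "\<And>u. u \<in> U \<Longrightarrow> A u \<in> sets borel" and C[measurable]: "C \<in> sets borel"
  shows "{f \<in> space (Pi\<^sub>M {0..1} (\<lambda>_. borel)). (\<forall>u\<in>U. f u \<in> A u) \<and> f t - f s \<in> C}
    \<in> sets (Pi\<^sub>M {0..1::real} (\<lambda>_. borel))"
proof -
  have [measurable]: "(\<lambda>f. f u) \<in> borel_measurable (Pi\<^sub>M {0..1::real} (\<lambda>_. borel :: real measure))"
    if "u \<in> {0..1}" for u
    using that by (rule measurable_component_singleton)
  have "{f \<in> space (Pi\<^sub>M {0..1} (\<lambda>_. borel)). f u \<in> A u} \<in> sets (Pi\<^sub>M {0..1::real} (\<lambda>_. borel))" if "u \<in> U" for u
    using that assms(2) measurable_sets[OF _ A[OF that],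
        of "\<lambda>f. f u" "Pi\<^sub>M {0..1::real} (\<lambda>_. borel :: real measure)"]
    by (auto simp: vimage_def Int_def conj_commute)
  moreover have "{f \<in> space (Pi\<^sub>M {0..1} (\<lambda>_. borel)). f t - f s \<in> C} \<in> sets (Pi\<^sub>M {0..1::real} (\<lambda>_. borel))"
    using assms(3,4) by measurable
  ultimately show ?thesis
    using \<open>finite U\<close> by (intro sets.sets_Collect_conj sets.sets_Collect_finite_All) auto
qed

text \<open>The probability is split into four factors, first between W and B, then between past and
  increment within each process, and the factors are regrouped into past and increment of the
  pair.\<close>

lemma (in prob_space) joint_cylinder_indep:
  assumes W: "std_brownian_motion M W" and B: "std_brownian_motion M B"
    and ind: "indep_processes M W B" and st: "0 \<le> s" "s < t" "t \<le> 1"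
    and U: "finite U" "U \<subseteq> {0..s}" "finite V" "V \<subseteq> {0..s}"
    and A: "\<And>u. u \<in> U \<Longrightarrow> A u \<in> sets borel" "\<And>u. u \<in> V \<Longrightarrow> A' u \<in> sets borel"
    and C: "C \<in> sets borel" "C' \<in> sets borel"
  shows "prob ({\<omega> \<in> space M. (\<forall>u\<in>U. W u \<omega> \<in> A u) \<and> (\<forall>u\<in>V. B u \<omega> \<in> A' u)} \<inter>
      {\<omega> \<in> space M. W t \<omega> - W s \<omega> \<in> C \<and> B t \<omega> - B s \<omega> \<in> C'}) =
    prob {\<omega> \<in> space M. (\<forall>u\<in>U. W u \<omega> \<in> A u) \<and> (\<forall>u\<in>V. B u \<omega> \<in> A' u)} *
    prob {\<omega> \<in> space M. W t \<omega> - W s \<omega> \<in> C \<and> B t \<omega> - B s \<omega> \<in> C'}"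
proof -
  \<comment> \<open>Stated for arbitrary index sets and targets because it serves three times: in
    full, with trivial increment conditions to recombine the pasts, and with empty index sets to
    recombine the increments.\<close>
  have prod: "prob {\<omega> \<in> space M. ((\<forall>u\<in>U. W u \<omega> \<in> A u) \<and> W t \<omega> - W s \<omega> \<in> D) \<and>
        ((\<forall>u\<in>V. B u \<omega> \<in> A' u) \<and> B t \<omega> - B s \<omega> \<in> D')} =
      prob {\<omega> \<in> space M. (\<forall>u\<in>U. W u \<omega> \<in> A u) \<and> W t \<omega> - W s \<omega> \<in> D} *
      prob {\<omega> \<in> space M. (\<forall>u\<in>V. B u \<omega> \<in> A' u) \<and> B t \<omega> - B s \<omega> \<in> D'}"
    if "finite U" "U \<subseteq> {0..s}" "finite V" "V \<subseteq> {0..s}"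
      "\<And>u. u \<in> U \<Longrightarrow> A u \<in> sets borel" "\<And>u. u \<in> V \<Longrightarrow> A' u \<in> sets borel"
      "D \<in> sets borel" "D' \<in> sets borel" for U V A A' D D'
  proof -
    have sub: "U \<subseteq> {0..1}" "V \<subseteq> {0..1}" using that(2,4) st by auto
    then have mem: "\<And>u. u \<in> U \<Longrightarrow> u \<in> {0..1}" "\<And>u. u \<in> V \<Longrightarrow> u \<in> {0..1}" by auto
    show ?thesis
      using indep_processesD[OF ind
          cylinder_increment_in_PiM[of U s t A D] cylinder_increment_in_PiM[of V s t A' D']]
        that sub mem st by (simp add: space_PiM cong: conj_cong ball_cong)
  qed
  have "prob ({\<omega> \<in> space M. (\<forall>u\<in>U. W u \<omega> \<in> A u) \<and> (\<forall>u\<in>V. B u \<omega> \<in> A' u)} \<inter>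
      {\<omega> \<in> space M. W t \<omega> - W s \<omega> \<in> C \<and> B t \<omega> - B s \<omega> \<in> C'}) =
     prob {\<omega> \<in> space M. ((\<forall>u\<in>U. W u \<omega> \<in> A u) \<and> W t \<omega> - W s \<omega> \<in> C) \<and>
        ((\<forall>u\<in>V. B u \<omega> \<in> A' u) \<and> B t \<omega> - B s \<omega> \<in> C')}"
    by (intro arg_cong[where f=prob]) auto
  also have "\<dots> = prob {\<omega> \<in> space M. (\<forall>u\<in>U. W u \<omega> \<in> A u) \<and> W t \<omega> - W s \<omega> \<in> C} *
      prob {\<omega> \<in> space M. (\<forall>u\<in>V. B u \<omega> \<in> A' u) \<and> B t \<omega> - B s \<omega> \<in> C'}"
    by (rule prod[OF U A C])
  also have "\<dots> = (prob {\<omega> \<in> space M. \<forall>u\<in>U. W u \<omega> \<in> A u} * prob {\<omega> \<in> space M. \<forall>u\<in>V. B u \<omega> \<in> A' u}) *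
      (prob {\<omega> \<in> space M. W t \<omega> - W s \<omega> \<in> C} * prob {\<omega> \<in> space M. B t \<omega> - B s \<omega> \<in> C'})"
    by (simp only: std_brownian_motion_cylinder_indep[OF W st U(1,2) A(1) C(1)]
        std_brownian_motion_cylinder_indep[OF B st U(3,4) A(2) C(2)] mult_ac)
  also have "prob {\<omega> \<in> space M. \<forall>u\<in>U. W u \<omega> \<in> A u} * prob {\<omega> \<in> space M. \<forall>u\<in>V. B u \<omega> \<in> A' u} =
      prob {\<omega> \<in> space M. (\<forall>u\<in>U. W u \<omega> \<in> A u) \<and> (\<forall>u\<in>V. B u \<omega> \<in> A' u)}"
    using prod[of U V A A' UNIV UNIV, OF U A] by simp
  also have "prob {\<omega> \<in> space M. W t \<omega> - W s \<omega> \<in> C} * prob {\<omega> \<in> space M. B t \<omega> - B s \<omega> \<in> C'} =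
      prob {\<omega> \<in> space M. W t \<omega> - W s \<omega> \<in> C \<and> B t \<omega> - B s \<omega> \<in> C'}"
    using prod[of "{}" "{}" "\<lambda>_. UNIV" "\<lambda>_. UNIV" C C'] C by simp
  finally show ?thesis .
qed

section \<open>The augmented filtration of a pair and its independence of later increments\<close>

lemma generated_filtration_sets:
  "space (generated_filtration M X t) = space M"
  "sets (generated_filtration M X t) = sigma_sets (space M)
     ({X s -` A \<inter> space M | s A. s \<in> {0..t} \<and> A \<in> sets borel} \<union> null_sets M)"
proof -
  have "{X s -` A \<inter> space M | s A. s \<in> {0..t} \<and> A \<in> sets borel} \<union> null_sets M \<subseteq> Pow (space M)"
    using sets.space_closed[of M] by (auto simp: null_sets_def)
  then show "space (generated_filtration M X t) = space M"
    "sets (generated_filtration M X t) = sigma_sets (space M)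
     ({X s -` A \<inter> space M | s A. s \<in> {0..t} \<and> A \<in> sets borel} \<union> null_sets M)"
    unfolding generated_filtration_def by simp_all
qed

lemma generated_filtration_mono:
  assumes "s \<le> t"
  shows "sets (generated_filtration M X s) \<subseteq> sets (generated_filtration M X t)"
  unfolding generated_filtration_sets
proof (rule sigma_sets_mono')
  have "{0..s} \<subseteq> {0..t}" using assms by auto
  then show "{X u -` A \<inter> space M | u A. u \<in> {0..s} \<and> A \<in> sets borel} \<union> null_sets M \<subseteq>
     {X u -` A \<inter> space M | u A. u \<in> {0..t} \<and> A \<in> sets borel} \<union> null_sets M" by blast
qed

lemma sets_generated_filtration_subset:
  assumes "\<And>s. s \<in> {0..t} \<Longrightarrow> X s \<in> borel_measurable M"
  shows "sets (generated_filtration M X t) \<subseteq> sets M"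
  unfolding generated_filtration_sets
proof (rule sets.sigma_sets_subset)
  show "{X s -` A \<inter> space M | s A. s \<in> {0..t} \<and> A \<in> sets borel} \<union> null_sets M \<subseteq> sets M"
    using assms by (auto intro: measurable_sets)
qed

lemma generated_filtration_adapted:
  assumes "s \<in> {0..t}"
  shows "X s \<in> borel_measurable (generated_filtration M X t)"
proof (rule measurableI)
  fix A :: "'b set" assume "A \<in> sets borel"
  then show "X s -` A \<inter> space (generated_filtration M X t) \<in> sets (generated_filtration M X t)"
    unfolding generated_filtration_sets using assms by (intro sigma_sets.Basic) blast
qed simp

text \<open>Cylinders together with null sets form a pi-system that generates a sigma-algebra
  containing the augmented past, and rectangles form one for the increments. Independence of the two
  pi-systems passes to the generated sigma-algebras; null sets are independent of
  everything.\<close>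

lemma generated_filtration_indep_increment:
  assumes "prob_space M"
    and W: "std_brownian_motion M W" and B: "std_brownian_motion M B"
    and ind: "indep_processes M W B" and st: "0 \<le> s" "s < t" "t \<le> 1"
    and E: "E \<in> sets (generated_filtration M (\<lambda>t \<omega>. (W t \<omega>, B t \<omega>)) s)"
    and H: "H \<in> sets (borel \<Otimes>\<^sub>M borel)"
  shows "measure M (E \<inter> {\<omega> \<in> space M. (W t \<omega> - W s \<omega>, B t \<omega> - B s \<omega>) \<in> H}) =
    measure M E * measure M {\<omega> \<in> space M. (W t \<omega> - W s \<omega>, B t \<omega> - B s \<omega>) \<in> H}"
proof -
  interpret prob_space M by fact
  have meas: "W u \<in> borel_measurable M" "B u \<in> borel_measurable M" if "u \<in> {0..1}" for u
    using W B that by (auto simp: std_brownian_motion_def)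
  have meas': "W u \<in> borel_measurable M" "B u \<in> borel_measurable M" if "u \<in> {0..s}" for u
    using meas[of u] that st by auto
  have [measurable]: "W s \<in> borel_measurable M" "B s \<in> borel_measurable M"
     "W t \<in> borel_measurable M" "B t \<in> borel_measurable M" using st meas by auto
  define F where "F = generated_filtration M (\<lambda>t \<omega>. (W t \<omega>, B t \<omega>)) s"
  define cyl where "cyl = {{\<omega> \<in> space M. (\<forall>u\<in>U. W u \<omega> \<in> A u) \<and> (\<forall>u\<in>V. B u \<omega> \<in> A' u)} | U A V A'.
    finite U \<and> U \<subseteq> {0..s} \<and> finite V \<and> V \<subseteq> {0..s} \<and>
    range A \<subseteq> sets (borel :: real measure) \<and> range A' \<subseteq> sets (borel :: real measure)}"
  define rect where "rect = {{\<omega> \<in> space M. W t \<omega> - W s \<omega> \<in> C \<and> B t \<omega> - B s \<omega> \<in> C'} | C C'.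
    C \<in> sets (borel :: real measure) \<and> C' \<in> sets (borel :: real measure)}"
  have cyl_sub: "cyl \<subseteq> events"
  proof
    fix E assume "E \<in> cyl"
    then obtain U A V A' where *: "E = {\<omega> \<in> space M. (\<forall>u\<in>U. W u \<omega> \<in> A u) \<and> (\<forall>u\<in>V. B u \<omega> \<in> A' u)}"
      "finite U" "U \<subseteq> {0..s}" "finite V" "V \<subseteq> {0..s}"
      "range A \<subseteq> sets borel" "range A' \<subseteq> sets borel"
      unfolding cyl_def by auto
    have "{\<omega> \<in> space M. W u \<omega> \<in> A u} \<in> events" if "u \<in> U" for u
      using measurable_sets[OF meas'(1), of u "A u"] that *
      by (auto simp: vimage_def Int_def conj_commute subset_iff)
    moreover have "{\<omega> \<in> space M. B u \<omega> \<in> A' u} \<in> events" if "u \<in> V" for u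
      using measurable_sets[OF meas'(2), of u "A' u"] that *
      by (auto simp: vimage_def Int_def conj_commute subset_iff)
    ultimately show "E \<in> events"
      unfolding *(1) using *(2,4)
      by (intro sets.sets_Collect_conj sets.sets_Collect_finite_All)
  qed
  have rect_sub: "rect \<subseteq> events"
    unfolding rect_def by auto
  have ind1: "indep_set (cyl \<union> null_sets M) rect"
  proof (rule indep_setI)
    fix a b assume ab: "a \<in> cyl \<union> null_sets M" "b \<in> rect"
    show "prob (a \<inter> b) = prob a * prob b"
    proof (cases "a \<in> null_sets M")
      case True
      then have "a \<inter> b \<in> null_sets M" using ab rect_sub by (intro null_set_Int2) auto
      then show ?thesis using True by (simp add: measure_eq_0_null_sets)
    next
      case False
      then have "a \<in> cyl" using ab by auto
      then show ?thesis using ab(2) unfolding cyl_def rect_def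
        by (auto intro!: joint_cylinder_indep[OF W B ind st])
    qed
  qed (use cyl_sub rect_sub in auto)
  have "Int_stable (cyl \<union> null_sets M)"
  proof (rule Int_stableI)
    fix a b assume ab: "a \<in> cyl \<union> null_sets M" "b \<in> cyl \<union> null_sets M"
    show "a \<inter> b \<in> cyl \<union> null_sets M"
    proof (cases "a \<in> null_sets M \<or> b \<in> null_sets M")
      case True
      then show ?thesis using ab cyl_sub by (auto intro: null_set_Int1 null_set_Int2)
    next
      case False
      then have "a \<in> cyl" "b \<in> cyl" using ab by auto
      then obtain U A V A' U' D V' D' where *:
        "a = {\<omega> \<in> space M. (\<forall>u\<in>U. W u \<omega> \<in> A u) \<and> (\<forall>u\<in>V. B u \<omega> \<in> A' u)}"
        "finite U" "U \<subseteq> {0..s}" "finite V" "V \<subseteq> {0..s}" "range A \<subseteq> sets borel" "range A' \<subseteq> sets borel"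
        "b = {\<omega> \<in> space M. (\<forall>u\<in>U'. W u \<omega> \<in> D u) \<and> (\<forall>u\<in>V'. B u \<omega> \<in> D' u)}"
        "finite U'" "U' \<subseteq> {0..s}" "finite V'" "V' \<subseteq> {0..s}" "range D \<subseteq> sets borel" "range D' \<subseteq> sets borel"
        unfolding cyl_def by auto
      \<comment> \<open>The two cylinders may constrain different times; conditions are padded with
        \<open>UNIV\<close> so that both live on the union of the index sets.\<close>
      define E where "E u = (if u \<in> U then A u else UNIV) \<inter> (if u \<in> U' then D u else UNIV)" for u
      define E' where "E' u = (if u \<in> V then A' u else UNIV) \<inter> (if u \<in> V' then D' u else UNIV)" for u
      have "a \<inter> b = {\<omega> \<in> space M. (\<forall>u\<in>U \<union> U'. W u \<omega> \<in> E u) \<and> (\<forall>u\<in>V \<union> V'. B u \<omega> \<in> E' u)}"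
        unfolding * E_def E'_def by (auto split: if_splits)
      moreover have "range E \<subseteq> sets borel" "range E' \<subseteq> sets borel"
        using * by (auto simp: E_def E'_def)
      ultimately have "a \<inter> b \<in> cyl" unfolding cyl_def using *
        by (intro CollectI exI[of _ "U \<union> U'"] exI[of _ E] exI[of _ "V \<union> V'"] exI[of _ E']) auto
      then show ?thesis ..
    qed
  qed
  moreover have "Int_stable rect"
  proof (rule Int_stableI)
    fix a b assume "a \<in> rect" "b \<in> rect"
    then obtain C C' D D' where *: "a = {\<omega> \<in> space M. W t \<omega> - W s \<omega> \<in> C \<and> B t \<omega> - B s \<omega> \<in> C'}"
       "b = {\<omega> \<in> space M. W t \<omega> - W s \<omega> \<in> D \<and> B t \<omega> - B s \<omega> \<in> D'}"
       "C \<in> sets borel" "C' \<in> sets borel" "D \<in> sets borel" "D' \<in> sets borel"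
      unfolding rect_def by auto
    then show "a \<inter> b \<in> rect" unfolding rect_def
      by (intro CollectI exI[of _ "C \<inter> D"] exI[of _ "C' \<inter> D'"]) auto
  qed
  ultimately have ind2: "indep_set (sigma_sets (space M) (cyl \<union> null_sets M)) (sigma_sets (space M) rect)"
    by (rule indep_set_sigma_sets[OF ind1])
  define G where "G = sigma (space M) (cyl \<union> null_sets M)"
  define R where "R = sigma (space M) rect"
  have G: "space G = space M" "sets G = sigma_sets (space M) (cyl \<union> null_sets M)"
    using cyl_sub sets.space_closed[of M] unfolding G_def
    by (auto simp: null_sets_def intro!: space_measure_of sets_measure_of)
  have R: "space R = space M" "sets R = sigma_sets (space M) rect"
    using rect_sub sets.space_closed[of M] unfolding R_def
    by (auto intro!: space_measure_of sets_measure_of)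
  have WG: "W u \<in> borel_measurable G" "B u \<in> borel_measurable G" if "u \<in> {0..s}" for u
  proof -
    have "W u -` A \<inter> space M \<in> cyl" if "A \<in> sets borel" for A
      using that \<open>u \<in> {0..s}\<close> unfolding cyl_def
      by (intro CollectI exI[of _ "{u}"] exI[of _ "\<lambda>_. A"] exI[of _ "{}"]) auto
    moreover have "B u -` A \<inter> space M \<in> cyl" if "A \<in> sets borel" for A
      using that \<open>u \<in> {0..s}\<close> unfolding cyl_def
      by (intro CollectI exI[of _ "{}"] exI[of _ "\<lambda>_. A"] exI[of _ "{u}"]) auto
    ultimately show "W u \<in> borel_measurable G" "B u \<in> borel_measurable G"
      by (auto intro!: measurableI simp: G)
  qed
  have WR: "(\<lambda>\<omega>. W t \<omega> - W s \<omega>) \<in> borel_measurable R" "(\<lambda>\<omega>. B t \<omega> - B s \<omega>) \<in> borel_measurable R"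
  proof -
    have "(\<lambda>\<omega>. W t \<omega> - W s \<omega>) -` A \<inter> space M \<in> rect" if "A \<in> sets borel" for A
      using that unfolding rect_def by (intro CollectI exI[of _ A] exI[of _ UNIV]) auto
    moreover have "(\<lambda>\<omega>. B t \<omega> - B s \<omega>) -` A \<inter> space M \<in> rect" if "A \<in> sets borel" for A
      using that unfolding rect_def by (intro CollectI exI[of _ UNIV] exI[of _ A]) auto
    ultimately show "(\<lambda>\<omega>. W t \<omega> - W s \<omega>) \<in> borel_measurable R" "(\<lambda>\<omega>. B t \<omega> - B s \<omega>) \<in> borel_measurable R"
      by (auto intro!: measurableI simp: R)
  qed
  \<comment> \<open>The filtration is generated by preimages of arbitrary Borel sets of the plane,
    not of rectangles; measurability of both coordinates for \<open>G\<close> suffices.\<close>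
  have FG: "sets F \<subseteq> sets G"
    unfolding F_def generated_filtration_sets G(2)
  proof (rule sigma_sets_mono, rule Un_least)
    show "null_sets M \<subseteq> sigma_sets (space M) (cyl \<union> null_sets M)" by auto
    show "{(\<lambda>\<omega>. (W u \<omega>, B u \<omega>)) -` A \<inter> space M | u A. u \<in> {0..s} \<and> A \<in> sets borel}
       \<subseteq> sigma_sets (space M) (cyl \<union> null_sets M)"
    proof safe
      fix u and A :: "(real \<times> real) set" assume u: "u \<in> {0..s}" and A: "A \<in> sets borel"
      have "(\<lambda>\<omega>. (W u \<omega>, B u \<omega>)) \<in> borel_measurable G"
        using WG[OF u] by (intro borel_measurable_Pair)
      from measurable_sets[OF this A]
      show "(\<lambda>\<omega>. (W u \<omega>, B u \<omega>)) -` A \<inter> space M \<in> sigma_sets (space M) (cyl \<union> null_sets M)"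
        by (simp add: G)
    qed
  qed
  have "(\<lambda>\<omega>. (W t \<omega> - W s \<omega>, B t \<omega> - B s \<omega>)) \<in> measurable R (borel \<Otimes>\<^sub>M borel)"
    using WR by (intro measurable_Pair)
  from measurable_sets[OF this H]
  have "{\<omega> \<in> space M. (W t \<omega> - W s \<omega>, B t \<omega> - B s \<omega>) \<in> H} \<in> sigma_sets (space M) rect"
    by (simp add: R vimage_def Int_def conj_commute)
  moreover have "E \<in> sigma_sets (space M) (cyl \<union> null_sets M)"
    using E FG by (auto simp: F_def G)
  ultimately show ?thesis by (intro indep_setD[OF ind2])
qed

section \<open>Exponential martingales of simple integrands\<close>

lemma mono_on_initial_segment:
  fixes r :: "nat \<Rightarrow> real"
  assumes "\<And>i. i < n \<Longrightarrow> r i \<le> r (Suc i)" "i \<le> j" "j \<le> n"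
  shows "r i \<le> r j"
  using assms(2,3)
proof (induction rule: dec_induct)
  case (step k)
  then show ?case using assms(1)[of k] by simp
qed simp

text \<open>The interface between Brownian motion and the martingale argument: the law of the
  increments enters only through their exponential moments. The filtration must lie inside the
  events only up to time 1, the end of the time interval.\<close>

locale brownian_filtration = prob_space M for M :: "'a measure" +
  fixes F :: "real \<Rightarrow> 'a measure" and Z :: "real \<Rightarrow> 'a \<Rightarrow> real"
  assumes space_F: "space (F t) = space M"
    and sets_F: "t \<le> 1 \<Longrightarrow> sets (F t) \<subseteq> sets M"
    and mono_F: "s \<le> t \<Longrightarrow> sets (F s) \<subseteq> sets (F t)"
    and adapted: "t \<in> {0..1} \<Longrightarrow> Z t \<in> borel_measurable (F t)"
    and indep_increment: "0 \<le> s \<Longrightarrow> s < t \<Longrightarrow> t \<le> 1 \<Longrightarrow>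
      A \<in> sets (F s) \<Longrightarrow> C \<in> sets borel \<Longrightarrow>
      prob (A \<inter> {\<omega> \<in> space M. Z t \<omega> - Z s \<omega> \<in> C}) = prob A * prob {\<omega> \<in> space M. Z t \<omega> - Z s \<omega> \<in> C}"
    and mgf_increment: "0 \<le> s \<Longrightarrow> s \<le> t \<Longrightarrow> t \<le> 1 \<Longrightarrow>
      (\<integral>\<^sup>+\<omega>. ennreal (exp (l * (Z t \<omega> - Z s \<omega>))) \<partial>M) = ennreal (exp (l\<^sup>2 * (t - s) / 2))"
begin

lemma measurable_F_mono: "s \<le> t \<Longrightarrow> f \<in> measurable (F s) N \<Longrightarrow> f \<in> measurable (F t) N"
  by (rule measurable_from_subalg) (auto simp: subalgebra_def space_F dest: mono_F)

lemma measurable_F_M: "t \<le> 1 \<Longrightarrow> f \<in> measurable (F t) N \<Longrightarrow> f \<in> measurable M N"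
  by (rule measurable_from_subalg) (auto simp: subalgebra_def space_F dest: sets_F)

lemma nn_integral_exp_increment:
  assumes st: "0 \<le> s" "s \<le> t" "t \<le> 1"
    and Y[measurable]: "Y \<in> borel_measurable (F s)" and \<xi>[measurable]: "\<xi> \<in> borel_measurable (F s)"
  shows "(\<integral>\<^sup>+\<omega>. Y \<omega> * ennreal (exp (\<xi> \<omega> * (Z t \<omega> - Z s \<omega>) - (\<xi> \<omega>)\<^sup>2 * (t - s) / 2)) \<partial>M) = (\<integral>\<^sup>+\<omega>. Y \<omega> \<partial>M)"
proof (cases "s = t")
  case False
  then have "s < t" using st by simp
  have Z[measurable]: "Z s \<in> borel_measurable M" "Z t \<in> borel_measurable M"
    using measurable_F_M[OF _ adapted, of s] measurable_F_M[OF _ adapted, of t] st by auto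
  have "(\<lambda>(\<omega>, z). Y \<omega> * ennreal (exp (\<xi> \<omega> * z - (\<xi> \<omega>)\<^sup>2 * (t - s) / 2)))
      \<in> borel_measurable (F s \<Otimes>\<^sub>M borel)" by measurable
  \<comment> \<open>The identity map into the smaller sigma-algebra plays the part of the past, so
    that any function measurable for \<open>F s\<close> becomes a parameter. This replaces
    conditioning on \<open>F s\<close>.\<close>
  moreover have "(\<lambda>\<omega>. \<omega>) \<in> measurable M (F s)"
    using st by (intro measurable_F_M[of s]) auto
  moreover have "prob {\<omega> \<in> space M. \<omega> \<in> A \<and> Z t \<omega> - Z s \<omega> \<in> C} =
      prob {\<omega> \<in> space M. \<omega> \<in> A} * prob {\<omega> \<in> space M. Z t \<omega> - Z s \<omega> \<in> C}"
    if "A \<in> sets (F s)" "C \<in> sets borel" for A C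
  proof -
    have "A \<subseteq> space M" using sets.sets_into_space[OF that(1)] by (simp add: space_F)
    then have "{\<omega> \<in> space M. \<omega> \<in> A \<and> Z t \<omega> - Z s \<omega> \<in> C} = A \<inter> {\<omega> \<in> space M. Z t \<omega> - Z s \<omega> \<in> C}"
      "{\<omega> \<in> space M. \<omega> \<in> A} = A" by auto
    then show ?thesis using indep_increment[OF st(1) \<open>s < t\<close> st(3) that] by simp
  qed
  ultimately have "(\<integral>\<^sup>+\<omega>. (case (\<omega>, Z t \<omega> - Z s \<omega>) of (\<omega>, z) \<Rightarrow> Y \<omega> * ennreal (exp (\<xi> \<omega> * z - (\<xi> \<omega>)\<^sup>2 * (t - s) / 2))) \<partial>M) =
    (\<integral>\<^sup>+\<omega>. \<integral>\<^sup>+\<omega>'. (case (\<omega>, Z t \<omega>' - Z s \<omega>') of (\<omega>, z) \<Rightarrow> Y \<omega> * ennreal (exp (\<xi> \<omega> * z - (\<xi> \<omega>)\<^sup>2 * (t - s) / 2))) \<partial>M \<partial>M)"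
    by (intro nn_integral_indep_pair[where S="F s" and T=borel]) simp_all
  then have "(\<integral>\<^sup>+\<omega>. Y \<omega> * ennreal (exp (\<xi> \<omega> * (Z t \<omega> - Z s \<omega>) - (\<xi> \<omega>)\<^sup>2 * (t - s) / 2)) \<partial>M) =
    (\<integral>\<^sup>+\<omega>. \<integral>\<^sup>+\<omega>'. Y \<omega> * ennreal (exp (\<xi> \<omega> * (Z t \<omega>' - Z s \<omega>') - (\<xi> \<omega>)\<^sup>2 * (t - s) / 2)) \<partial>M \<partial>M)"
    by simp
  also have "\<dots> = (\<integral>\<^sup>+\<omega>. Y \<omega> \<partial>M)"
  proof (rule nn_integral_cong)
    fix \<omega>
    have "(\<integral>\<^sup>+\<omega>'. Y \<omega> * ennreal (exp (\<xi> \<omega> * (Z t \<omega>' - Z s \<omega>') - (\<xi> \<omega>)\<^sup>2 * (t - s) / 2)) \<partial>M) =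
      (\<integral>\<^sup>+\<omega>'. (Y \<omega> * ennreal (exp (- ((\<xi> \<omega>)\<^sup>2 * (t - s) / 2)))) * ennreal (exp (\<xi> \<omega> * (Z t \<omega>' - Z s \<omega>'))) \<partial>M)"
      by (simp add: mult.assoc ennreal_mult[symmetric] exp_add[symmetric])
    also have "\<dots> = (Y \<omega> * ennreal (exp (- ((\<xi> \<omega>)\<^sup>2 * (t - s) / 2)))) * ennreal (exp ((\<xi> \<omega>)\<^sup>2 * (t - s) / 2))"
      by (subst nn_integral_cmult) (simp_all add: mgf_increment st)
    also have "\<dots> = Y \<omega>"
      by (simp add: mult.assoc ennreal_mult[symmetric] exp_add[symmetric])
    finally show "(\<integral>\<^sup>+\<omega>'. Y \<omega> * ennreal (exp (\<xi> \<omega> * (Z t \<omega>' - Z s \<omega>') - (\<xi> \<omega>)\<^sup>2 * (t - s) / 2)) \<partial>M) = Y \<omega>" .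
  qed
  finally show ?thesis .
qed simp

text \<open>Tower property: the last factor is integrated out first, since \<open>Y\<close> and all
  earlier factors are measurable at the start of its interval.\<close>

lemma nn_integral_exp_increments:
  assumes "0 \<le> \<rho> 0" "\<And>i. i < n \<Longrightarrow> \<rho> i \<le> \<rho> (Suc i)" "\<rho> n \<le> 1"
    and "Y \<in> borel_measurable (F (\<rho> 0))" "\<And>i. i < n \<Longrightarrow> \<xi> i \<in> borel_measurable (F (\<rho> i))"
  shows "(\<integral>\<^sup>+\<omega>. Y \<omega> * ennreal (exp (\<Sum>i<n. \<xi> i \<omega> * (Z (\<rho> (Suc i)) \<omega> - Z (\<rho> i) \<omega>) -
      (\<xi> i \<omega>)\<^sup>2 * (\<rho> (Suc i) - \<rho> i) / 2)) \<partial>M) = (\<integral>\<^sup>+\<omega>. Y \<omega> \<partial>M)"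
  using assms
proof (induction n)
  case (Suc n)
  have mono: "\<rho> i \<le> \<rho> j" if "i \<le> j" "j \<le> Suc n" for i j
    using mono_on_initial_segment[where r=\<rho>, OF Suc.prems(2) that] .
  have "0 \<le> \<rho> i" if "i \<le> Suc n" for i using mono[of 0 i] that Suc.prems(1) by simp
  moreover have "\<rho> i \<le> 1" if "i \<le> Suc n" for i using mono[of i "Suc n"] that Suc.prems(3) by simp
  ultimately have 01: "\<rho> i \<in> {0..1}" if "i \<le> Suc n" for i using that by simp
  define E where "E \<omega> = (\<Sum>i<n. \<xi> i \<omega> * (Z (\<rho> (Suc i)) \<omega> - Z (\<rho> i) \<omega>) - (\<xi> i \<omega>)\<^sup>2 * (\<rho> (Suc i) - \<rho> i) / 2)" for \<omega>
  have Z_meas: "Z (\<rho> i) \<in> borel_measurable (F (\<rho> n))" if "i \<le> n" for i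
    using that 01 mono by (intro measurable_F_mono[OF _ adapted]) auto
  have \<xi>_meas: "\<xi> i \<in> borel_measurable (F (\<rho> n))" if "i \<le> n" for i
    using that mono by (intro measurable_F_mono[OF _ Suc.prems(5)]) auto
  have [measurable]: "E \<in> borel_measurable (F (\<rho> n))"
    unfolding E_def[abs_def]
    by (intro borel_measurable_sum borel_measurable_diff borel_measurable_times borel_measurable_divide
        borel_measurable_power borel_measurable_const Z_meas \<xi>_meas) auto
  have [measurable]: "Y \<in> borel_measurable (F (\<rho> n))"
    using mono by (intro measurable_F_mono[OF _ Suc.prems(4)]) auto
  have "(\<integral>\<^sup>+\<omega>. Y \<omega> * ennreal (exp (\<Sum>i<Suc n. \<xi> i \<omega> * (Z (\<rho> (Suc i)) \<omega> - Z (\<rho> i) \<omega>) -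
      (\<xi> i \<omega>)\<^sup>2 * (\<rho> (Suc i) - \<rho> i) / 2)) \<partial>M) =
     (\<integral>\<^sup>+\<omega>. (Y \<omega> * ennreal (exp (E \<omega>))) * ennreal (exp (\<xi> n \<omega> * (Z (\<rho> (Suc n)) \<omega> - Z (\<rho> n) \<omega>) -
      (\<xi> n \<omega>)\<^sup>2 * (\<rho> (Suc n) - \<rho> n) / 2)) \<partial>M)"
    unfolding E_def by (simp add: exp_add ennreal_mult mult.assoc)
  also have "\<dots> = (\<integral>\<^sup>+\<omega>. Y \<omega> * ennreal (exp (E \<omega>)) \<partial>M)"
    using 01[of n] 01[of "Suc n"] mono[of n "Suc n"] by (intro nn_integral_exp_increment \<xi>_meas) auto
  also have "\<dots> = (\<integral>\<^sup>+\<omega>. Y \<omega> \<partial>M)"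
    unfolding E_def using 01[of n] by (intro Suc.IH) (auto intro: Suc.prems)
  finally show ?case .
qed simp

end

text \<open>The bracket of \<open>simple_integral\<close>: for an ordered partition of nonnegative
  times this is the integral of the squared simple process over [0, t]. The clipping by
  \<open>min\<close> matches \<open>simple_integral\<close> term by term.\<close>

definition simple_qvar :: "nat \<Rightarrow> (nat \<Rightarrow> real) \<Rightarrow> (nat \<Rightarrow> 'a \<Rightarrow> real) \<Rightarrow> real \<Rightarrow> 'a \<Rightarrow> real" where
  "simple_qvar n \<tau> \<xi> t \<omega> = (\<Sum>i<n. (\<xi> i \<omega>)\<^sup>2 * (min (\<tau> (Suc i)) t - min (\<tau> i) t))"

lemma simple_integrand_partition:
  assumes "simple_integrand M F n \<tau> \<xi>"
  shows "i \<le> j \<Longrightarrow> j \<le> n \<Longrightarrow> \<tau> i \<le> \<tau> j" and "i \<le> n \<Longrightarrow> \<tau> i \<in> {0..1}"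
proof -
  have step: "0 \<le> \<tau> 0" "\<And>i. i < n \<Longrightarrow> \<tau> i \<le> \<tau> (Suc i)" "\<tau> n \<le> 1"
    using assms by (auto simp: simple_integrand_def)
  have mono: "\<tau> i \<le> \<tau> j" if "i \<le> j" "j \<le> n" for i j
    using mono_on_initial_segment[where r=\<tau>, OF step(2) that] .
  then show "i \<le> j \<Longrightarrow> j \<le> n \<Longrightarrow> \<tau> i \<le> \<tau> j" .
  show "i \<le> n \<Longrightarrow> \<tau> i \<in> {0..1}" using mono[of 0 i] mono[of i n] step by auto
qed

context brownian_filtration
begin

definition simple_exponential ::
    "nat \<Rightarrow> (nat \<Rightarrow> real) \<Rightarrow> (nat \<Rightarrow> 'a \<Rightarrow> real) \<Rightarrow> real \<Rightarrow> real \<Rightarrow> 'a \<Rightarrow> real" where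
  "simple_exponential n \<tau> \<xi> \<theta> t \<omega> =
     exp (\<theta> * simple_integral Z n \<tau> \<xi> t \<omega> - \<theta>\<^sup>2 / 2 * simple_qvar n \<tau> \<xi> t \<omega>)"

text \<open>A coefficient whose interval starts after t need not be measurable for
  \<open>F t\<close>, but its term is identically 0 because both clipped endpoints equal t.\<close>

lemma simple_integral_measurable:
  assumes \<xi>: "simple_integrand M F n \<tau> \<xi>" and t: "t \<in> {0..1}"
  shows "simple_integral Z n \<tau> \<xi> t \<in> borel_measurable (F t)"
    and "simple_qvar n \<tau> \<xi> t \<in> borel_measurable (F t)"
proof -
  note part = simple_integrand_partition[OF \<xi>]
  have \<xi>_meas: "\<xi> i \<in> borel_measurable (F t)" if "i < n" "\<tau> i \<le> t" for i
    using \<xi> that by (intro measurable_F_mono[OF that(2)]) (auto simp: simple_integrand_def)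
  have Z_meas: "Z (min (\<tau> i) t) \<in> borel_measurable (F t)" if "i \<le> n" for i
    using part(2)[OF that] t by (intro measurable_F_mono[OF _ adapted]) auto
  have "(\<lambda>\<omega>. \<xi> i \<omega> * (Z (min (\<tau> (Suc i)) t) \<omega> - Z (min (\<tau> i) t) \<omega>)) \<in> borel_measurable (F t)"
    "(\<lambda>\<omega>. (\<xi> i \<omega>)\<^sup>2 * (min (\<tau> (Suc i)) t - min (\<tau> i) t)) \<in> borel_measurable (F t)" if "i < n" for i
  proof (atomize (full), cases "\<tau> i \<le> t")
    case True
    note [measurable] = \<xi>_meas[OF \<open>i < n\<close> True]
    have [measurable]: "Z (min (\<tau> (Suc i)) t) \<in> borel_measurable (F t)" "Z (min (\<tau> i) t) \<in> borel_measurable (F t)"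
      using that by (auto intro: Z_meas)
    show "(\<lambda>\<omega>. \<xi> i \<omega> * (Z (min (\<tau> (Suc i)) t) \<omega> - Z (min (\<tau> i) t) \<omega>)) \<in> borel_measurable (F t) \<and>
      (\<lambda>\<omega>. (\<xi> i \<omega>)\<^sup>2 * (min (\<tau> (Suc i)) t - min (\<tau> i) t)) \<in> borel_measurable (F t)"
      by measurable
  next
    case False
    then have "min (\<tau> (Suc i)) t = t" "min (\<tau> i) t = t" using part(1)[of i "Suc i"] that by auto
    then show "(\<lambda>\<omega>. \<xi> i \<omega> * (Z (min (\<tau> (Suc i)) t) \<omega> - Z (min (\<tau> i) t) \<omega>)) \<in> borel_measurable (F t) \<and>
      (\<lambda>\<omega>. (\<xi> i \<omega>)\<^sup>2 * (min (\<tau> (Suc i)) t - min (\<tau> i) t)) \<in> borel_measurable (F t)"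
      by simp
  qed
  then show "simple_integral Z n \<tau> \<xi> t \<in> borel_measurable (F t)"
    "simple_qvar n \<tau> \<xi> t \<in> borel_measurable (F t)"
    unfolding simple_integral_def[abs_def] simple_qvar_def[abs_def]
    by (auto intro!: borel_measurable_sum)
qed

lemma simple_exponential_measurable:
  assumes "simple_integrand M F n \<tau> \<xi>" and "t \<in> {0..1}"
  shows "simple_exponential n \<tau> \<xi> \<theta> t \<in> borel_measurable (F t)"
  using simple_integral_measurable[OF assms] unfolding simple_exponential_def[abs_def] by measurable

text \<open>The quotient of the exponentials at t and at s is again a product of compensated
  exponential increments, all starting at s or later, so it integrates to 1 against any weight from
  the past.\<close>

lemma simple_exponential_martingale:
  assumes \<xi>: "simple_integrand M F n \<tau> \<xi>" and st: "0 \<le> s" "s \<le> t" "t \<le> 1" and A: "A \<in> sets (F s)"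
  shows "(\<integral>\<^sup>+\<omega>. ennreal (simple_exponential n \<tau> \<xi> \<theta> t \<omega>) * indicator A \<omega> \<partial>M) =
    (\<integral>\<^sup>+\<omega>. ennreal (simple_exponential n \<tau> \<xi> \<theta> s \<omega>) * indicator A \<omega> \<partial>M)"
proof -
  note part = simple_integrand_partition[OF \<xi>]
  \<comment> \<open>Clipping the partition to \<open>[s,t]\<close> avoids a common refinement; \<open>\<eta>\<close> vanishes on the cells beyond \<open>t\<close>,
    where the increments are zero but \<open>\<xi> i\<close> need not be measurable for \<open>F t\<close>.\<close>
  define c where "c u = max s (min u t)" for u
  define \<eta> where "\<eta> i \<omega> = (if \<tau> i \<le> t then \<theta> * \<xi> i \<omega> else 0)" for i \<omega>
  \<comment> \<open>At least one of \<open>min u s\<close> and \<open>c u\<close> equals s,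
    according to the side of s on which u lies; the other one is \<open>min u t\<close>. Hence the
    identity holds for times and for values of Z alike.\<close>
  have split: "min u t = min u s + c u - s" "Z (min u t) \<omega> = Z (min u s) \<omega> + Z (c u) \<omega> - Z s \<omega>" for u \<omega>
    using st by (auto simp: c_def min_def max_def)
  have \<eta>: "\<theta> * (\<xi> i \<omega> * (Z (c (\<tau> (Suc i))) \<omega> - Z (c (\<tau> i)) \<omega>)) -
      \<theta>\<^sup>2 / 2 * ((\<xi> i \<omega>)\<^sup>2 * (c (\<tau> (Suc i)) - c (\<tau> i))) =
      \<eta> i \<omega> * (Z (c (\<tau> (Suc i))) \<omega> - Z (c (\<tau> i)) \<omega>) - (\<eta> i \<omega>)\<^sup>2 * (c (\<tau> (Suc i)) - c (\<tau> i)) / 2"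
    if "i < n" for i \<omega>
  proof (cases "\<tau> i \<le> t")
    case True
    then show ?thesis by (simp add: \<eta>_def power2_eq_square)
  next
    case False
    then have "c (\<tau> i) = t" "c (\<tau> (Suc i)) = t" using part(1)[of i "Suc i"] that st by (auto simp: c_def)
    then show ?thesis by simp
  qed
  have log_split: "\<theta> * simple_integral Z n \<tau> \<xi> t \<omega> - \<theta>\<^sup>2 / 2 * simple_qvar n \<tau> \<xi> t \<omega> =
     (\<theta> * simple_integral Z n \<tau> \<xi> s \<omega> - \<theta>\<^sup>2 / 2 * simple_qvar n \<tau> \<xi> s \<omega>) +
     (\<Sum>i<n. \<theta> * (\<xi> i \<omega> * (Z (c (\<tau> (Suc i))) \<omega> - Z (c (\<tau> i)) \<omega>)) -
      \<theta>\<^sup>2 / 2 * ((\<xi> i \<omega>)\<^sup>2 * (c (\<tau> (Suc i)) - c (\<tau> i))))" for \<omega>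
    unfolding simple_integral_def simple_qvar_def sum_distrib_left sum_subtractf[symmetric] sum.distrib[symmetric]
    by (intro sum.cong refl, simp only: split(2), simp only: split(1)) (simp add: algebra_simps)
  have exp_split: "simple_exponential n \<tau> \<xi> \<theta> t \<omega> = simple_exponential n \<tau> \<xi> \<theta> s \<omega> *
      exp (\<Sum>i<n. \<eta> i \<omega> * (Z (c (\<tau> (Suc i))) \<omega> - Z (c (\<tau> i)) \<omega>) - (\<eta> i \<omega>)\<^sup>2 * (c (\<tau> (Suc i)) - c (\<tau> i)) / 2)" for \<omega>
    unfolding simple_exponential_def log_split exp_add
    by (intro arg_cong2[where f="(*)"] arg_cong[where f=exp] sum.cong refl) (simp only: \<eta> lessThan_iff)
  let ?Y = "\<lambda>\<omega>. ennreal (simple_exponential n \<tau> \<xi> \<theta> s \<omega>) * indicator A \<omega>"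
  have "(\<integral>\<^sup>+\<omega>. ennreal (simple_exponential n \<tau> \<xi> \<theta> t \<omega>) * indicator A \<omega> \<partial>M) =
    (\<integral>\<^sup>+\<omega>. ?Y \<omega> * ennreal (exp (\<Sum>i<n. \<eta> i \<omega> * (Z (c (\<tau> (Suc i))) \<omega> - Z (c (\<tau> i)) \<omega>) -
      (\<eta> i \<omega>)\<^sup>2 * (c (\<tau> (Suc i)) - c (\<tau> i)) / 2)) \<partial>M)"
    unfolding exp_split
    by (intro nn_integral_cong) (simp add: ennreal_mult simple_exponential_def mult_ac)
  also have "\<dots> = (\<integral>\<^sup>+\<omega>. ?Y \<omega> \<partial>M)"
  proof (rule nn_integral_exp_increments)
    have [measurable]: "simple_exponential n \<tau> \<xi> \<theta> s \<in> borel_measurable (F s)"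
      using st by (intro simple_exponential_measurable[OF \<xi>]) auto
    have "?Y \<in> borel_measurable (F s)" using A by measurable
    then show "?Y \<in> borel_measurable (F (c (\<tau> 0)))"
      by (rule measurable_F_mono[rotated]) (simp add: c_def)
    fix i assume "i < n"
    then have m: "\<xi> i \<in> borel_measurable (F (\<tau> i))" using \<xi> by (auto simp: simple_integrand_def)
    show "\<eta> i \<in> borel_measurable (F (c (\<tau> i)))"
    proof (cases "\<tau> i \<le> t")
      case True
      then have [measurable]: "\<xi> i \<in> borel_measurable (F (c (\<tau> i)))"
        by (intro measurable_F_mono[OF _ m]) (auto simp: c_def)
      show ?thesis using True unfolding \<eta>_def[abs_def] by simp
    qed (simp add: \<eta>_def[abs_def])
    show "c (\<tau> i) \<le> c (\<tau> (Suc i))" using part(1)[of i "Suc i"] \<open>i < n\<close> by (auto simp: c_def)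
  qed (use st in \<open>auto simp: c_def\<close>)
  finally show ?thesis .
qed

lemma nn_integral_simple_exponential:
  assumes \<xi>: "simple_integrand M F n \<tau> \<xi>" and t: "t \<in> {0..1}"
  shows "(\<integral>\<^sup>+\<omega>. ennreal (simple_exponential n \<tau> \<xi> \<theta> t \<omega>) \<partial>M) = 1"
proof -
  note part = simple_integrand_partition[OF \<xi>]
  have "simple_exponential n \<tau> \<xi> \<theta> 0 \<omega> = 1" for \<omega>
    using part(2) by (simp add: simple_exponential_def simple_integral_def simple_qvar_def min_absorb2)
  then show ?thesis
    using simple_exponential_martingale[OF \<xi>, of 0 t "space M" \<theta>] t sets.top[of "F 0"]
    by (simp add: space_F emeasure_space_1 cong: nn_integral_cong)
qed

text \<open>Doob's argument: the event is split by the first grid index at which the exponential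
  reaches \<open>exp a\<close>. On each piece the martingale property replaces the value at that
  index by the value at the final index, and the pieces together carry at most its mean, 1.\<close>

lemma simple_integral_maximal:
  fixes m :: nat
  assumes \<xi>: "simple_integrand M F n \<tau> \<xi>" and r: "incseq r" "\<And>j. r j \<in> {0..1}"
  shows "prob {\<omega> \<in> space M. \<exists>j\<le>m. a \<le> \<theta> * simple_integral Z n \<tau> \<xi> (r j) \<omega> - \<theta>\<^sup>2 / 2 * simple_qvar n \<tau> \<xi> (r j) \<omega>}
    \<le> exp (- a)"
proof -
  define E where "E j \<omega> = simple_exponential n \<tau> \<xi> \<theta> (r j) \<omega>" for j \<omega>
  define P where "P j = {\<omega> \<in> space M. exp a \<le> E j \<omega>}" for j
  have E_meas: "E j \<in> borel_measurable (F (r j))" for j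
    unfolding E_def using simple_exponential_measurable[OF \<xi> r(2)] by simp
  have [measurable]: "E j \<in> borel_measurable M" for j
    using E_meas[of j] r(2)[of j] by (intro measurable_F_M) auto
  have "{\<omega> \<in> space (F (r j)). exp a \<le> E j \<omega>} \<in> sets (F (r j))" for j
    using E_meas[of j] by measurable
  then have P: "P j \<in> sets (F (r j))" for j by (simp add: P_def space_F)
  \<comment> \<open>This is the event that the level is first reached at index j; it lies in
    \<open>F (r j)\<close> because the grid is increasing.\<close>
  have D: "disjointed P j \<in> sets (F (r j))" for j
    unfolding disjointed_def
  proof (intro sets.Diff sets.finite_UN P)
    fix i assume "i \<in> {0..<j}"
    then show "P i \<in> sets (F (r j))" using mono_F[OF incseqD[OF r(1), of i j]] P[of i] by auto
  qed simp
  have D_M[measurable]: "disjointed P j \<in> sets M" for j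
    using D sets_F[of "r j"] r(2)[of j] by auto
  have "{\<omega> \<in> space M. \<exists>j\<le>m. a \<le> \<theta> * simple_integral Z n \<tau> \<xi> (r j) \<omega> - \<theta>\<^sup>2 / 2 * simple_qvar n \<tau> \<xi> (r j) \<omega>} =
    (\<Union>j<Suc m. P j)"
    by (auto simp: P_def E_def simple_exponential_def less_Suc_eq_le)
  also have "\<dots> = (\<Union>j<Suc m. disjointed P j)"
    using finite_UN_disjointed_eq[of P "Suc m"] by (simp add: atLeast0LessThan)
  finally have eq: "{\<omega> \<in> space M. \<exists>j\<le>m. a \<le> \<theta> * simple_integral Z n \<tau> \<xi> (r j) \<omega> - \<theta>\<^sup>2 / 2 * simple_qvar n \<tau> \<xi> (r j) \<omega>} =
    (\<Union>j<Suc m. disjointed P j)" .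
  have disj: "disjoint_family_on (disjointed P) {..<Suc m}"
    using disjoint_family_disjointed[of P] by (auto simp: disjoint_family_on_def)
  have "ennreal (exp a) * emeasure M (\<Union>j<Suc m. disjointed P j) = (\<Sum>j<Suc m. ennreal (exp a) * emeasure M (disjointed P j))"
    unfolding sum_distrib_left[symmetric] using disj by (subst sum_emeasure) auto
  also have "\<dots> \<le> (\<Sum>j<Suc m. \<integral>\<^sup>+\<omega>. ennreal (E m \<omega>) * indicator (disjointed P j) \<omega> \<partial>M)"
  proof (rule sum_mono)
    fix j assume "j \<in> {..<Suc m}"
    then have "r j \<le> r m" using r(1) by (auto intro: incseqD)
    have "ennreal (exp a) * emeasure M (disjointed P j) = (\<integral>\<^sup>+\<omega>. ennreal (exp a) * indicator (disjointed P j) \<omega> \<partial>M)"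
      by (simp add: nn_integral_cmult_indicator)
    also have "\<dots> \<le> (\<integral>\<^sup>+\<omega>. ennreal (E j \<omega>) * indicator (disjointed P j) \<omega> \<partial>M)"
      using disjointed_subset[of P j] by (intro nn_integral_mono) (auto simp: P_def indicator_def intro!: ennreal_leI)
    also have "\<dots> = (\<integral>\<^sup>+\<omega>. ennreal (E m \<omega>) * indicator (disjointed P j) \<omega> \<partial>M)"
      unfolding E_def using r(2)[of j] r(2)[of m] \<open>r j \<le> r m\<close> D
      by (intro simple_exponential_martingale[OF \<xi>, symmetric]) auto
    finally show "ennreal (exp a) * emeasure M (disjointed P j) \<le> \<dots>" .
  qed
  also have "\<dots> = (\<integral>\<^sup>+\<omega>. ennreal (E m \<omega>) * indicator (\<Union>j<Suc m. disjointed P j) \<omega> \<partial>M)"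
    using disj by (subst nn_integral_sum[symmetric]) (auto simp: sum_distrib_left[symmetric] indicator_UN_disjoint simp del: sum.lessThan_Suc)
  also have "\<dots> \<le> (\<integral>\<^sup>+\<omega>. ennreal (E m \<omega>) \<partial>M)"
    by (intro nn_integral_mono) (auto simp: indicator_def)
  also have "\<dots> = 1" unfolding E_def by (rule nn_integral_simple_exponential[OF \<xi> r(2)])
  finally have "ennreal (exp a * prob (\<Union>j<Suc m. disjointed P j)) \<le> ennreal 1"
    by (simp add: emeasure_eq_measure ennreal_mult)
  then show ?thesis unfolding eq by (simp add: exp_minus field_simps)
qed

end

section \<open>A maximal inequality for the stochastic integral\<close>

text \<open>Joint measurability of a process is assumed over [0,1] only, so Tonelli and
  measurability of sections are applied on the restricted measure.\<close>

abbreviation unit_lborel :: "real measure" where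
  "unit_lborel \<equiv> restrict_space lborel {0..1}"

lemma partition_sum_indicator:
  fixes r :: "nat \<Rightarrow> real" and f :: "nat \<Rightarrow> 'b::{zero_neq_one, semiring_1}"
  assumes r: "\<And>i j. i \<le> j \<Longrightarrow> j \<le> n \<Longrightarrow> r i \<le> r j" and i: "i < n" "u \<in> {r i<..r (Suc i)}"
  shows "(\<Sum>k<n. f k * indicator {r k<..r (Suc k)} u) = f i"
proof -
  have "f k * indicator {r k<..r (Suc k)} u = (if k = i then f i else 0)" if "k < n" for k
    using r[of "Suc k" i] r[of "Suc i" k] i that by (cases k i rule: linorder_cases) auto
  then have "(\<Sum>k<n. f k * indicator {r k<..r (Suc k)} u) = (\<Sum>k<n. if k = i then f i else 0)"
    by (intro sum.cong) auto
  also have "\<dots> = f i" using i by simp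
  finally show ?thesis .
qed

text \<open>A pathwise estimate, with \<open>g\<close> standing for a path of the volatility. The
  bracket is an integral of the squared simple process, which is compared with \<open>g\<close>
  pointwise; the error integral runs over all of [0,1] so that one quantity serves all times
  t.\<close>

lemma simple_qvar_le:
  fixes g :: "real \<Rightarrow> real"
  assumes \<xi>: "simple_integrand M F n \<tau> \<xi>" and t: "t \<in> {0..1}"
    and g[measurable]: "g \<in> borel_measurable unit_lborel"
    and bound: "AE u in unit_lborel. \<bar>g u\<bar> \<le> \<beta>"
  shows "ennreal (simple_qvar n \<tau> \<xi> t \<omega>) \<le>
    ennreal (2 * \<beta>\<^sup>2 * t) + 2 * (\<integral>\<^sup>+u. ennreal ((simple_value n \<tau> \<xi> u \<omega> - g u)\<^sup>2) \<partial>unit_lborel)"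
proof -
  note part = simple_integrand_partition[OF \<xi>]
  define r where "r i = min (\<tau> i) t" for i
  have r: "r i \<le> r j" if "i \<le> j" "j \<le> n" for i j
    using part(1)[OF that] by (auto simp: r_def)
  \<comment> \<open>The squared simple process cut off at time t: at most one of the clipped
    intervals contains a given u, so squaring commutes with the sum.\<close>
  define S where "S u = (\<Sum>i<n. ennreal ((\<xi> i \<omega>)\<^sup>2) * indicator {r i<..r (Suc i)} u)" for u
  have [measurable]: "S \<in> borel_measurable borel" unfolding S_def[abs_def] by measurable
  have sv[measurable]: "(\<lambda>u. simple_value n \<tau> \<xi> u \<omega>) \<in> borel_measurable borel"
    unfolding simple_value_def by measurable
  have svU[measurable]: "(\<lambda>u. simple_value n \<tau> \<xi> u \<omega>) \<in> borel_measurable unit_lborel"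
    by (rule measurable_restrict_space1) simp
  have "ennreal (simple_qvar n \<tau> \<xi> t \<omega>) = (\<Sum>i<n. ennreal ((\<xi> i \<omega>)\<^sup>2 * (r (Suc i) - r i)))"
    unfolding simple_qvar_def r_def[symmetric] using r
    by (subst sum_ennreal) (auto intro!: mult_nonneg_nonneg)
  also have "\<dots> = (\<Sum>i<n. \<integral>\<^sup>+u. ennreal ((\<xi> i \<omega>)\<^sup>2) * indicator {r i<..r (Suc i)} u \<partial>lborel)"
    using r by (intro sum.cong) (auto simp: nn_integral_cmult_indicator ennreal_mult)
  also have "\<dots> = (\<integral>\<^sup>+u. S u \<partial>lborel)"
    unfolding S_def by (subst nn_integral_sum) auto
  also have "\<dots> = (\<integral>\<^sup>+u. S u * indicator {0..1} u \<partial>lborel)"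
  proof (intro nn_integral_cong)
    fix u
    have "indicator {r i<..r (Suc i)} u = (0::ennreal)" if "u \<notin> {0..1}" "i < n" for i
      using part(2)[of i] part(2)[of "Suc i"] that t by (auto simp: r_def indicator_def)
    then show "S u = S u * indicator {0..1} u"
      by (cases "u \<in> {0..1}") (auto simp: S_def intro!: sum.neutral)
  qed
  also have "\<dots> = (\<integral>\<^sup>+u. S u \<partial>unit_lborel)"
    by (subst nn_integral_restrict_space) auto
  also have "\<dots> \<le> (\<integral>\<^sup>+u. ennreal (2 * \<beta>\<^sup>2) * indicator {0..t} u +
      2 * ennreal ((simple_value n \<tau> \<xi> u \<omega> - g u)\<^sup>2) \<partial>unit_lborel)"
  proof (rule nn_integral_mono_AE, use bound in eventually_elim)
    fix u assume gu: "\<bar>g u\<bar> \<le> \<beta>"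
    show "S u \<le> ennreal (2 * \<beta>\<^sup>2) * indicator {0..t} u + 2 * ennreal ((simple_value n \<tau> \<xi> u \<omega> - g u)\<^sup>2)"
    proof (cases "\<exists>i<n. u \<in> {r i<..r (Suc i)}")
      case True
      then obtain i where i: "i < n" "u \<in> {r i<..r (Suc i)}" by auto
      then have u: "u \<in> {\<tau> i<..\<tau> (Suc i)}" "u \<in> {0..t}"
        using part(2)[of i] t by (auto simp: r_def)
      have "S u = ennreal ((\<xi> i \<omega>)\<^sup>2)"
        unfolding S_def by (rule partition_sum_indicator[OF r i]) auto
      moreover have v: "simple_value n \<tau> \<xi> u \<omega> = \<xi> i \<omega>"
        unfolding simple_value_def by (rule partition_sum_indicator[OF part(1) i(1) u(1)]) auto
      moreover have "(\<xi> i \<omega>)\<^sup>2 \<le> 2 * \<beta>\<^sup>2 + 2 * (\<xi> i \<omega> - g u)\<^sup>2"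
      proof -
        have "(g u)\<^sup>2 \<le> \<beta>\<^sup>2" using gu by (simp add: abs_le_square_iff[symmetric])
        \<comment> \<open>This square is exactly the difference between
          \<open>2 * (g u)\<^sup>2 + 2 * (\<xi> i \<omega> - g u)\<^sup>2\<close> and
          \<open>(\<xi> i \<omega>)\<^sup>2\<close>.\<close>
        moreover have "0 \<le> (\<xi> i \<omega> - 2 * g u)\<^sup>2" by simp
        ultimately show ?thesis by (simp add: power2_eq_square algebra_simps)
      qed
      then have "ennreal ((\<xi> i \<omega>)\<^sup>2) \<le> ennreal (2 * \<beta>\<^sup>2) + 2 * ennreal ((\<xi> i \<omega> - g u)\<^sup>2)"
        by (simp add: ennreal_plus[symmetric] ennreal_mult[symmetric] ennreal_numeral[symmetric]
            del: ennreal_plus ennreal_numeral)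
      ultimately show ?thesis using u by simp
    next
      case False
      then have "S u = 0" unfolding S_def by (intro sum.neutral) auto
      then show ?thesis by simp
    qed
  qed
  also have "\<dots> = (\<integral>\<^sup>+u. ennreal (2 * \<beta>\<^sup>2) * indicator {0..t} u \<partial>unit_lborel) +
      2 * (\<integral>\<^sup>+u. ennreal ((simple_value n \<tau> \<xi> u \<omega> - g u)\<^sup>2) \<partial>unit_lborel)"
  proof -
    have [measurable]: "(indicator {0..t} :: real \<Rightarrow> ennreal) \<in> borel_measurable unit_lborel"
      by (rule measurable_restrict_space1) simp
    show ?thesis by (subst nn_integral_add) (auto simp: nn_integral_cmult)
  qed
  also have "(\<integral>\<^sup>+u. ennreal (2 * \<beta>\<^sup>2) * indicator {0..t} u \<partial>unit_lborel) =
     (\<integral>\<^sup>+u. ennreal (2 * \<beta>\<^sup>2) * indicator {0..t} u \<partial>lborel)"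
    using t by (subst nn_integral_restrict_space) (auto intro!: nn_integral_cong simp: indicator_def)
  also have "\<dots> = ennreal (2 * \<beta>\<^sup>2 * t)"
    using t by (simp add: nn_integral_cmult_indicator ennreal_mult)
  finally show ?thesis .
qed

lemma jointly_measurable_unit_lborel:
  "jointly_measurable M H \<longleftrightarrow> (\<lambda>(t, \<omega>). H t \<omega>) \<in> borel_measurable (unit_lborel \<Otimes>\<^sub>M M)"
  unfolding jointly_measurable_def
  by (intro arg_cong2[where f="(\<in>)"] measurable_cong_sets refl sets_pair_measure_cong sets_restrict_space_cong) simp

lemma sigma_finite_unit_lborel: "sigma_finite_measure unit_lborel"
  by (intro sigma_finite_measure_restrict_space sigma_finite_lborel) auto

text \<open>Fubini for null sets: a property valid almost surely at almost every time holds, on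
  almost every path, at almost every time. The bracket estimate needs the second form, being
  pathwise.\<close>

lemma (in prob_space) jointly_measurable_AE_commute:
  assumes H: "jointly_measurable M H" and Q: "{y :: real. Q y} \<in> sets borel"
    and AE: "AE t in lborel. t \<in> {0..1} \<longrightarrow> (AE \<omega> in M. Q (H t \<omega>))"
  shows "AE \<omega> in M. AE t in unit_lborel. Q (H t \<omega>)"
proof -
  interpret U: sigma_finite_measure unit_lborel by (rule sigma_finite_unit_lborel)
  interpret pair_sigma_finite unit_lborel M ..
  have "{p \<in> space (unit_lborel \<Otimes>\<^sub>M M). Q (H (fst p) (snd p))} \<in> sets (unit_lborel \<Otimes>\<^sub>M M)"
    using measurable_sets[OF H[unfolded jointly_measurable_unit_lborel] Q]
    by (simp add: vimage_def Int_def conj_commute case_prod_beta)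
  from AE_commute[OF this] show ?thesis
    using AE by (simp add: AE_restrict_space_iff)
qed

context brownian_filtration
begin

text \<open>If J exceeds d at a grid point, then either the approximating exponent is large there,
  or the approximation fails at that point, or the integrand is approximated badly on the path. The
  first case is Doob's, the others vanish in the limit by Markov's inequality. The grid is finite
  because mean-square convergence holds separately at each time; the resulting bound does not depend
  on m.\<close>

lemma ito_integral_maximal:
  fixes m :: nat
  assumes J: "has_ito_integral M F Z \<sigma> J" and \<sigma>: "jointly_measurable M \<sigma>"
    and bound: "AE t in lborel. t \<in> {0..1} \<longrightarrow> (AE \<omega> in M. \<bar>\<sigma> t \<omega>\<bar> \<le> \<beta>)"
    and T: "T \<le> 1" and r: "incseq r" "\<And>j. r j \<in> {0..T}" and \<theta>: "0 < \<theta>"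
  shows "prob {\<omega> \<in> space M. \<exists>j\<le>m. d < J (r j) \<omega>} \<le> exp (- (\<theta> * d) + \<theta>\<^sup>2 * \<beta>\<^sup>2 * T)"
proof -
  interpret U: sigma_finite_measure unit_lborel by (rule sigma_finite_unit_lborel)
  have r01: "r j \<in> {0..1}" for j using r(2)[of j] T by auto
  from J obtain n \<tau> \<xi> where simple: "\<And>k. simple_integrand M F (n k) (\<tau> k) (\<xi> k)"
    and H_lim: "(\<lambda>k. \<integral>\<^sup>+\<omega>. (\<integral>\<^sup>+t\<in>{0..1}.
           ennreal ((simple_value (n k) (\<tau> k) (\<xi> k) t \<omega> - \<sigma> t \<omega>)\<^sup>2) \<partial>lborel) \<partial>M) \<longlonglongrightarrow> 0"
    and I_lim: "\<And>t. t \<in> {0..1} \<Longrightarrow> (\<lambda>k. \<integral>\<^sup>+\<omega>.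
           ennreal ((simple_integral Z (n k) (\<tau> k) (\<xi> k) t \<omega> - J t \<omega>)\<^sup>2) \<partial>M) \<longlonglongrightarrow> 0"
    unfolding has_ito_integral_def by blast
  have J_meas[measurable]: "J (r j) \<in> borel_measurable M" for j
    using J r01 by (auto simp: has_ito_integral_def)
  define I where "I k t = simple_integral Z (n k) (\<tau> k) (\<xi> k) t" for k t
  define Q where "Q k t = simple_qvar (n k) (\<tau> k) (\<xi> k) t" for k t
  define D where "D k \<omega> = (\<integral>\<^sup>+u. ennreal ((simple_value (n k) (\<tau> k) (\<xi> k) u \<omega> - \<sigma> u \<omega>)\<^sup>2) \<partial>unit_lborel)" for k \<omega>
  have I_meas[measurable]: "I k (r j) \<in> borel_measurable M" "Q k (r j) \<in> borel_measurable M" for k j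
    using simple_integral_measurable[OF simple r01, THEN measurable_F_M[rotated]] r01[of j]
    by (auto simp: I_def Q_def)
  have \<sigma>_meas[measurable]: "(\<lambda>(t, \<omega>). \<sigma> t \<omega>) \<in> borel_measurable (unit_lborel \<Otimes>\<^sub>M M)"
    using \<sigma> by (simp add: jointly_measurable_unit_lborel)
  have D_meas[measurable]: "D k \<in> borel_measurable M" for k
  proof -
    have [measurable]: "\<xi> k i \<in> borel_measurable M" if "i < n k" for i
      using simple[of k] simple_integrand_partition(2)[OF simple[of k], of i] that
      by (intro measurable_F_M[of "\<tau> k i"]) (auto simp: simple_integrand_def)
    have [measurable]: "(indicator {\<tau> k i<..\<tau> k (Suc i)} :: real \<Rightarrow> real) \<in> borel_measurable unit_lborel" for i
      by (rule measurable_restrict_space1) simp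
    have [measurable]: "(\<lambda>(\<omega>, u). simple_value (n k) (\<tau> k) (\<xi> k) u \<omega>) \<in> borel_measurable (M \<Otimes>\<^sub>M unit_lborel)"
      unfolding simple_value_def case_prod_beta by (intro borel_measurable_sum) measurable
    have [measurable]: "(\<lambda>(\<omega>, u). \<sigma> u \<omega>) \<in> borel_measurable (M \<Otimes>\<^sub>M unit_lborel)"
      using measurable_pair_swap[OF \<sigma>_meas] by (simp add: case_prod_beta)
    show ?thesis unfolding D_def[abs_def] by measurable
  qed
  have D_lim: "(\<lambda>k. \<integral>\<^sup>+\<omega>. D k \<omega> \<partial>M) \<longlonglongrightarrow> 0"
    using H_lim unfolding D_def by (subst nn_integral_restrict_space) auto
  have bound_set: "{y :: real. \<bar>y\<bar> \<le> \<beta>} \<in> sets borel" by measurable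
  have path_bound: "AE \<omega> in M. \<forall>k j. ennreal (Q k (r j) \<omega>) \<le> ennreal (2 * \<beta>\<^sup>2 * r j) + 2 * D k \<omega>"
    using jointly_measurable_AE_commute[where Q="\<lambda>y. \<bar>y\<bar> \<le> \<beta>", OF \<sigma> bound_set bound] AE_space
  proof eventually_elim
    case (elim \<omega>)
    have "(\<lambda>u. \<sigma> u \<omega>) \<in> borel_measurable unit_lborel"
      using measurable_compose[OF measurable_Pair2'[OF \<open>\<omega> \<in> space M\<close>] \<sigma>_meas] by simp
    then show ?case
      unfolding Q_def D_def using simple_qvar_le[OF simple r01 _ elim(1)] by blast
  qed
  have approx: "prob {\<omega> \<in> space M. \<exists>j\<le>m. d < J (r j) \<omega>} \<le>
      exp (- (\<theta> * (d - \<delta>) - \<theta>\<^sup>2 * \<beta>\<^sup>2 * T - \<theta>\<^sup>2 * \<delta>))" if \<delta>: "0 < \<delta>" for \<delta>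
  proof -
    \<comment> \<open>The lower bound for the exponent when the simple integral is at least
      \<open>d - \<delta>\<close> and its bracket at most
      \<open>2 * \<beta>\<^sup>2 * T + 2 * \<delta>\<close>.\<close>
    define a where "a = \<theta> * (d - \<delta>) - \<theta>\<^sup>2 * \<beta>\<^sup>2 * T - \<theta>\<^sup>2 * \<delta>"
    define G where "G = {\<omega> \<in> space M. \<exists>j\<le>m. d < J (r j) \<omega>}"
    define A where "A k = {\<omega> \<in> space M. \<exists>j\<le>m. a \<le> \<theta> * I k (r j) \<omega> - \<theta>\<^sup>2 / 2 * Q k (r j) \<omega>}" for k
    \<comment> \<open>These events say that the integrals differ by at least \<delta>, and
      \<open>C k\<close> that the integrand error is at least \<delta>; both are scaled to the form
      required by Markov's inequality.\<close>
    define B where "B k j = {\<omega> \<in> space M. 1 \<le> ennreal (1 / \<delta>\<^sup>2) * ennreal ((I k (r j) \<omega> - J (r j) \<omega>)\<^sup>2)}" for k j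
    define C where "C k = {\<omega> \<in> space M. 1 \<le> ennreal (1 / \<delta>) * D k \<omega>}" for k
    have [measurable]: "G \<in> events" "A k \<in> events" "B k j \<in> events" "C k \<in> events" for k j
      unfolding G_def A_def B_def C_def by measurable
    have "emeasure M G \<le> ennreal (exp (- a)) +
        (\<Sum>j\<le>m. ennreal (1 / \<delta>\<^sup>2) * (\<integral>\<^sup>+\<omega>. ennreal ((I k (r j) \<omega> - J (r j) \<omega>)\<^sup>2) \<partial>M)) +
        ennreal (1 / \<delta>) * (\<integral>\<^sup>+\<omega>. D k \<omega> \<partial>M)" for k
    proof -
      have "AE \<omega> in M. \<omega> \<in> G \<longrightarrow> \<omega> \<in> A k \<union> (\<Union>j\<le>m. B k j) \<union> C k"
        using path_bound
      proof eventually_elim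
        case (elim \<omega>)
        show ?case
        proof (intro impI, rule ccontr)
          assume "\<omega> \<in> G" and no: "\<omega> \<notin> A k \<union> (\<Union>j\<le>m. B k j) \<union> C k"
          then obtain j where j: "\<omega> \<in> space M" "j \<le> m" "d < J (r j) \<omega>" by (auto simp: G_def)
          have "\<not> 1 \<le> ennreal (1 / \<delta>\<^sup>2) * ennreal ((I k (r j) \<omega> - J (r j) \<omega>)\<^sup>2)"
            using no j by (auto simp: B_def)
          then have "\<not> 1 \<le> 1 / \<delta>\<^sup>2 * (I k (r j) \<omega> - J (r j) \<omega>)\<^sup>2"
            by (simp add: ennreal_mult[symmetric] ennreal_1[symmetric] del: ennreal_1)
          then have "(I k (r j) \<omega> - J (r j) \<omega>)\<^sup>2 < \<delta>\<^sup>2" using \<delta> by (simp add: field_simps)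
          then have "\<bar>I k (r j) \<omega> - J (r j) \<omega>\<bar> < \<delta>" using \<delta> by (metis abs_of_pos power2_abs power2_less_imp_less less_imp_le)
          then have I: "d - \<delta> \<le> I k (r j) \<omega>" using j by auto
          have "D k \<omega> < ennreal \<delta>"
          proof (rule ccontr)
            assume "\<not> D k \<omega> < ennreal \<delta>"
            then have "ennreal (1 / \<delta>) * ennreal \<delta> \<le> ennreal (1 / \<delta>) * D k \<omega>" by (intro mult_left_mono) auto
            moreover have "ennreal (1 / \<delta>) * ennreal \<delta> = 1" using \<delta> by (simp add: ennreal_mult[symmetric])
            ultimately show False using no j by (auto simp: C_def)
          qed
          then have "ennreal (2 * \<beta>\<^sup>2 * r j) + 2 * D k \<omega> \<le> ennreal (2 * \<beta>\<^sup>2 * r j) + 2 * ennreal \<delta>"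
            by (intro add_left_mono mult_left_mono) auto
          also have "\<dots> = ennreal (2 * \<beta>\<^sup>2 * r j + 2 * \<delta>)"
            using \<delta> r01[of j] by (simp add: ennreal_mult[symmetric] ennreal_plus[symmetric] ennreal_numeral[symmetric]
                del: ennreal_plus ennreal_numeral)
          finally have "ennreal (Q k (r j) \<omega>) \<le> ennreal (2 * \<beta>\<^sup>2 * r j + 2 * \<delta>)"
            using elim by (meson order_trans)
          then have "Q k (r j) \<omega> \<le> 2 * \<beta>\<^sup>2 * r j + 2 * \<delta>"
            using \<delta> r01[of j] by (subst (asm) ennreal_le_iff) auto
          also have "\<dots> \<le> 2 * \<beta>\<^sup>2 * T + 2 * \<delta>"
            using r(2)[of j] by (auto intro!: mult_left_mono)
          finally have "\<theta>\<^sup>2 / 2 * Q k (r j) \<omega> \<le> \<theta>\<^sup>2 / 2 * (2 * \<beta>\<^sup>2 * T + 2 * \<delta>)"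
            by (intro mult_left_mono) auto
          moreover have "\<theta> * (d - \<delta>) \<le> \<theta> * I k (r j) \<omega>" using I \<theta> by (intro mult_left_mono) auto
          ultimately have "a \<le> \<theta> * I k (r j) \<omega> - \<theta>\<^sup>2 / 2 * Q k (r j) \<omega>"
            by (simp add: a_def algebra_simps)
          then show False using no j by (auto simp: A_def)
        qed
      qed
      then have "emeasure M G \<le> emeasure M (A k \<union> (\<Union>j\<le>m. B k j) \<union> C k)"
        by (rule emeasure_mono_AE) measurable
      also have "\<dots> \<le> emeasure M (A k \<union> (\<Union>j\<le>m. B k j)) + emeasure M (C k)"
        by (rule emeasure_subadditive) measurable
      also have "\<dots> \<le> (emeasure M (A k) + emeasure M (\<Union>j\<le>m. B k j)) + emeasure M (C k)"
        by (intro add_right_mono emeasure_subadditive) measurable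
      also have "\<dots> \<le> (emeasure M (A k) + (\<Sum>j\<le>m. emeasure M (B k j))) + emeasure M (C k)"
        by (intro add_right_mono add_left_mono emeasure_subadditive_finite) auto
      also have "\<dots> \<le> ennreal (exp (- a)) +
        (\<Sum>j\<le>m. ennreal (1 / \<delta>\<^sup>2) * (\<integral>\<^sup>+\<omega>. ennreal ((I k (r j) \<omega> - J (r j) \<omega>)\<^sup>2) \<partial>M)) +
        ennreal (1 / \<delta>) * (\<integral>\<^sup>+\<omega>. D k \<omega> \<partial>M)"
      proof (intro add_mono sum_mono)
        show "emeasure M (A k) \<le> ennreal (exp (- a))"
          unfolding A_def I_def Q_def emeasure_eq_measure
          by (intro ennreal_leI simple_integral_maximal[OF simple r(1) r01])
        have "emeasure M (C k) \<le> ennreal (1 / \<delta>) * (\<integral>\<^sup>+\<omega>. D k \<omega> * indicator (space M) \<omega> \<partial>M)"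
          unfolding C_def by (rule nn_integral_Markov_inequality) auto
        then show "emeasure M (C k) \<le> ennreal (1 / \<delta>) * (\<integral>\<^sup>+\<omega>. D k \<omega> \<partial>M)"
          by (simp cong: nn_integral_cong)
        fix j
        have "emeasure M (B k j) \<le> ennreal (1 / \<delta>\<^sup>2) *
            (\<integral>\<^sup>+\<omega>. ennreal ((I k (r j) \<omega> - J (r j) \<omega>)\<^sup>2) * indicator (space M) \<omega> \<partial>M)"
          unfolding B_def by (rule nn_integral_Markov_inequality) auto
        then show "emeasure M (B k j) \<le> ennreal (1 / \<delta>\<^sup>2) *
            (\<integral>\<^sup>+\<omega>. ennreal ((I k (r j) \<omega> - J (r j) \<omega>)\<^sup>2) \<partial>M)"
          by (simp cong: nn_integral_cong)
      qed
      finally show ?thesis .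
    qed
    \<comment> \<open>Here k tends to infinity with \<delta> and m fixed, so the error is a finite
      sum of null sequences.\<close>
    moreover have "(\<lambda>k. ennreal (exp (- a)) +
        (\<Sum>j\<le>m. ennreal (1 / \<delta>\<^sup>2) * (\<integral>\<^sup>+\<omega>. ennreal ((I k (r j) \<omega> - J (r j) \<omega>)\<^sup>2) \<partial>M)) +
        ennreal (1 / \<delta>) * (\<integral>\<^sup>+\<omega>. D k \<omega> \<partial>M)) \<longlonglongrightarrow>
        ennreal (exp (- a)) + (\<Sum>j\<le>m. ennreal (1 / \<delta>\<^sup>2) * 0) + ennreal (1 / \<delta>) * 0"
      unfolding I_def
      by (intro tendsto_add tendsto_const tendsto_sum ennreal_tendsto_cmult I_lim[OF r01] D_lim) auto
    ultimately have "emeasure M G \<le> ennreal (exp (- a)) + (\<Sum>j\<le>m. ennreal (1 / \<delta>\<^sup>2) * 0) + ennreal (1 / \<delta>) * 0"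
      by (intro LIMSEQ_le_const) auto
    then have "prob G \<le> exp (- a)" by (simp add: emeasure_eq_measure)
    then show ?thesis by (simp add: G_def a_def)
  qed
  \<comment> \<open>Letting \<delta> decrease to 0 removes the tolerance from both the level and the
    bracket.\<close>
  have "((\<lambda>\<delta>. exp (- (\<theta> * (d - \<delta>) - \<theta>\<^sup>2 * \<beta>\<^sup>2 * T - \<theta>\<^sup>2 * \<delta>))) \<longlongrightarrow>
      exp (- (\<theta> * (d - 0) - \<theta>\<^sup>2 * \<beta>\<^sup>2 * T - \<theta>\<^sup>2 * 0))) (at_right 0)"
    by (intro tendsto_intros)
  moreover have "\<forall>\<^sub>F \<delta> in at_right 0. prob {\<omega> \<in> space M. \<exists>j\<le>m. d < J (r j) \<omega>} \<le>
      exp (- (\<theta> * (d - \<delta>) - \<theta>\<^sup>2 * \<beta>\<^sup>2 * T - \<theta>\<^sup>2 * \<delta>))"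
    using eventually_at_right_less[of "0::real"] by eventually_elim (rule approx)
  ultimately have "prob {\<omega> \<in> space M. \<exists>j\<le>m. d < J (r j) \<omega>} \<le> exp (- (\<theta> * (d - 0) - \<theta>\<^sup>2 * \<beta>\<^sup>2 * T - \<theta>\<^sup>2 * 0))"
    by (rule tendsto_lowerbound) simp
  then show ?thesis by simp
qed

end

section \<open>The barrier event\<close>

text \<open>An increment of Z is a linear image of the increment of the pair, which transfers
  independence of the past. Independence of W and B multiplies the moment generating functions, and
  the variances \<rho>^2 and 1 - \<rho>^2 add up to 1.\<close>

lemma brownian_filtration_combination:
  assumes "prob_space M"
    and W: "std_brownian_motion M W" and B: "std_brownian_motion M B"
    and ind: "indep_processes M W B" and \<rho>: "\<bar>\<rho>\<bar> \<le> 1"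
  shows "brownian_filtration M (generated_filtration M (\<lambda>t \<omega>. (W t \<omega>, B t \<omega>)))
    (\<lambda>t \<omega>. \<rho> * W t \<omega> + sqrt (1 - \<rho>\<^sup>2) * B t \<omega>)"
proof -
  interpret prob_space M by fact
  let ?F = "generated_filtration M (\<lambda>t \<omega>. (W t \<omega>, B t \<omega>))"
  have meas: "W u \<in> borel_measurable M" "B u \<in> borel_measurable M" if "u \<in> {0..1}" for u
    using W B that by (auto simp: std_brownian_motion_def)
  show ?thesis
  proof
    show "space (?F t) = space M" for t by (rule generated_filtration_sets)
    show "sets (?F s) \<subseteq> sets (?F t)" if "s \<le> t" for s t by (rule generated_filtration_mono[OF that])
    show "sets (?F t) \<subseteq> sets M" if "t \<le> 1" for t
      using that by (intro sets_generated_filtration_subset borel_measurable_Pair meas) auto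
    show "(\<lambda>\<omega>. \<rho> * W t \<omega> + sqrt (1 - \<rho>\<^sup>2) * B t \<omega>) \<in> borel_measurable (?F t)" if "t \<in> {0..1}" for t
    proof -
      have WB: "(\<lambda>\<omega>. (W t \<omega>, B t \<omega>)) \<in> borel_measurable (?F t)"
        using that by (intro generated_filtration_adapted) auto
      have "(\<lambda>p. \<rho> * fst p + sqrt (1 - \<rho>\<^sup>2) * snd p) \<in> borel_measurable (borel :: (real \<times> real) measure)"
        by (intro borel_measurable_continuous_onI continuous_intros)
      from measurable_compose[OF WB this] show ?thesis by simp
    qed
  next
    fix s t :: real and A and C :: "real set"
    assume st: "0 \<le> s" "s < t" "t \<le> 1" and A: "A \<in> sets (?F s)" and C: "C \<in> sets borel"
    define H where "H = (\<lambda>(x, y). \<rho> * x + sqrt (1 - \<rho>\<^sup>2) * y) -` C \<inter> space (borel \<Otimes>\<^sub>M borel :: (real \<times> real) measure)"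
    have "(\<lambda>(x, y). \<rho> * x + sqrt (1 - \<rho>\<^sup>2) * y) \<in> borel_measurable (borel \<Otimes>\<^sub>M borel :: (real \<times> real) measure)"
      by measurable
    then have H: "H \<in> sets (borel \<Otimes>\<^sub>M borel)" unfolding H_def using C by (rule measurable_sets)
    have "\<rho> * W t \<omega> + sqrt (1 - \<rho>\<^sup>2) * B t \<omega> - (\<rho> * W s \<omega> + sqrt (1 - \<rho>\<^sup>2) * B s \<omega>) \<in> C \<longleftrightarrow>
      (W t \<omega> - W s \<omega>, B t \<omega> - B s \<omega>) \<in> H" for \<omega>
      by (simp add: H_def space_pair_measure algebra_simps)
    then show "prob (A \<inter> {\<omega> \<in> space M. \<rho> * W t \<omega> + sqrt (1 - \<rho>\<^sup>2) * B t \<omega> - (\<rho> * W s \<omega> + sqrt (1 - \<rho>\<^sup>2) * B s \<omega>) \<in> C}) =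
      prob A * prob {\<omega> \<in> space M. \<rho> * W t \<omega> + sqrt (1 - \<rho>\<^sup>2) * B t \<omega> - (\<rho> * W s \<omega> + sqrt (1 - \<rho>\<^sup>2) * B s \<omega>) \<in> C}"
      using generated_filtration_indep_increment[OF \<open>prob_space M\<close> W B ind st A H] by simp
  next
    fix s t l :: real assume st: "0 \<le> s" "s \<le> t" "t \<le> 1"
    have [measurable]: "W t \<in> borel_measurable M" "W s \<in> borel_measurable M"
      "B t \<in> borel_measurable M" "B s \<in> borel_measurable M" using st meas by auto
    let ?c = "sqrt (1 - \<rho>\<^sup>2)"
    have "?c\<^sup>2 = 1 - \<rho>\<^sup>2" using \<rho> by (simp add: abs_square_le_1)
    have indep: "prob {\<omega> \<in> space M. W t \<omega> - W s \<omega> \<in> A \<and> B t \<omega> - B s \<omega> \<in> C} =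
        prob {\<omega> \<in> space M. W t \<omega> - W s \<omega> \<in> A} * prob {\<omega> \<in> space M. B t \<omega> - B s \<omega> \<in> C}"
      if "A \<in> sets borel" "C \<in> sets borel" for A C
      using indep_processesD[OF ind cylinder_increment_in_PiM[of "{}" s t _ A]
          cylinder_increment_in_PiM[of "{}" s t _ C]] that st by (simp add: space_PiM)
    have "(\<integral>\<^sup>+\<omega>. ennreal (exp (l * (\<rho> * W t \<omega> + ?c * B t \<omega> - (\<rho> * W s \<omega> + ?c * B s \<omega>)))) \<partial>M) =
      (\<integral>\<^sup>+\<omega>. (\<lambda>(x, y). ennreal (exp (l * \<rho> * x)) * ennreal (exp (l * ?c * y))) (W t \<omega> - W s \<omega>, B t \<omega> - B s \<omega>) \<partial>M)"
      by (simp add: ennreal_mult[symmetric] exp_add[symmetric] algebra_simps)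
    also have "\<dots> = (\<integral>\<^sup>+\<omega>. \<integral>\<^sup>+\<omega>'. (\<lambda>(x, y). ennreal (exp (l * \<rho> * x)) * ennreal (exp (l * ?c * y)))
        (W t \<omega> - W s \<omega>, B t \<omega>' - B s \<omega>') \<partial>M \<partial>M)"
      by (rule nn_integral_indep_pair[where S=borel and T=borel]) (simp_all add: indep)
    also have "\<dots> = (\<integral>\<^sup>+\<omega>. ennreal (exp (l * \<rho> * (W t \<omega> - W s \<omega>))) * ennreal (exp ((l * ?c)\<^sup>2 * (t - s) / 2)) \<partial>M)"
      by (simp add: nn_integral_cmult std_brownian_motion_mgf[OF B st])
    also have "\<dots> = ennreal (exp ((l * \<rho>)\<^sup>2 * (t - s) / 2)) * ennreal (exp ((l * ?c)\<^sup>2 * (t - s) / 2))"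
      by (simp add: nn_integral_multc std_brownian_motion_mgf[OF W st])
    also have "\<dots> = ennreal (exp (l\<^sup>2 * (t - s) / 2))"
    proof -
      have "(l * \<rho>)\<^sup>2 * (t - s) / 2 + (l * ?c)\<^sup>2 * (t - s) / 2 = l\<^sup>2 * (\<rho>\<^sup>2 + ?c\<^sup>2) * (t - s) / 2"
        by (simp add: power_mult_distrib algebra_simps add_divide_distrib diff_divide_distrib)
      also have "\<dots> = l\<^sup>2 * (t - s) / 2" by (simp add: \<open>?c\<^sup>2 = 1 - \<rho>\<^sup>2\<close>)
      finally show ?thesis by (simp add: ennreal_mult[symmetric] exp_add[symmetric])
    qed
    finally show "(\<integral>\<^sup>+\<omega>. ennreal (exp (l * (\<rho> * W t \<omega> + ?c * B t \<omega> - (\<rho> * W s \<omega> + ?c * B s \<omega>)))) \<partial>M) =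
      ennreal (exp (l\<^sup>2 * (t - s) / 2))" .
  qed
qed

section \<open>From dyadic grids to the running maximum\<close>

lemma continuous_sup_gt_imp_dyadic_gt:
  fixes f :: "real \<Rightarrow> real"
  assumes T: "0 < T" and f: "continuous_on {0..T} f" and t: "t \<in> {0..T}" "y < f t"
  shows "\<exists>k. \<exists>j\<le>2 ^ k. y < f (T * (real j / 2 ^ k))"
proof -
  have "0 < f t - y" using t by simp
  then obtain \<delta> where \<delta>: "0 < \<delta>" "\<And>u. u \<in> {0..T} \<Longrightarrow> dist u t < \<delta> \<Longrightarrow> dist (f u) (f t) < f t - y"
    using f t(1) unfolding continuous_on_iff by metis
  obtain k where k: "T / \<delta> < 2 ^ k" using real_arch_pow[of 2 "T / \<delta>"] by auto
  \<comment> \<open>Rounding down keeps the grid point inside [0, T], including the case t =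
    T.\<close>
  define j where "j = nat \<lfloor>t * 2 ^ k / T\<rfloor>"
  have "0 \<le> t * 2 ^ k / T" using t T by simp
  then have j: "real j \<le> t * 2 ^ k / T" "t * 2 ^ k / T < real j + 1"
    unfolding j_def by linarith+
  have "real j \<le> 2 ^ k"
  proof -
    have "t * 2 ^ k / T \<le> 2 ^ k" using t T by (simp add: field_simps)
    then show ?thesis using j by linarith
  qed
  then have j_le: "j \<le> 2 ^ k" by (metis of_nat_le_iff of_nat_numeral of_nat_power)
  let ?u = "T * (real j / 2 ^ k)"
  have u: "?u \<le> t" "t < ?u + T / 2 ^ k" using j T by (simp_all add: field_simps)
  have "T / 2 ^ k < \<delta>" using k \<delta>(1) by (simp add: field_simps)
  then have "dist ?u t < \<delta>" using u by (simp add: dist_real_def)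
  moreover have "?u \<in> {0..T}" using u t T by auto
  ultimately have "dist (f ?u) (f t) < f t - y" by (intro \<delta>(2))
  then have "y < f ?u" by (simp add: dist_real_def)
  then show ?thesis using j_le by blast
qed

context brownian_filtration
begin

text \<open>The barrier event involves an uncountable supremum, so it is enclosed in a union of
  increasing grid events, whose measurability is immediate. The bound is uniform in the grid and
  passes to the union by continuity from below.\<close>

lemma barrier_event_tail:
  assumes J: "has_ito_integral M F Z \<sigma> J" and \<sigma>: "jointly_measurable M \<sigma>"
    and bound: "AE t in lborel. t \<in> {0..1} \<longrightarrow> (AE \<omega> in M. \<bar>\<sigma> t \<omega>\<bar> \<le> \<beta>)" and \<beta>: "0 < \<beta>"
    and X: "\<And>t. t \<in> {0..1} \<Longrightarrow> X t \<in> borel_measurable M"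
    and X_le: "\<And>t. t \<in> {0..1} \<Longrightarrow> AE \<omega> in M. X t \<omega> \<le> x + J t \<omega>"
    and cont: "\<And>\<omega>. \<omega> \<in> space M \<Longrightarrow> continuous_on {0..1} (\<lambda>t. X t \<omega>)"
    and T: "0 < T" "T \<le> 1" and b: "x < b"
  shows "\<exists>A\<in>events. barrier_event M (\<lambda>t \<omega>. exp (X t \<omega>)) (exp b) T \<subseteq> A \<and>
    prob A \<le> exp (- ((b - x)\<^sup>2 / (16 * \<beta>\<^sup>2 * T)))"
proof -
  \<comment> \<open>At the barrier X is only known to be at least b; a strictly lower level leaves
    room for a nearby dyadic point to exceed it.\<close>
  define d where "d = (b - x) / 2"
  \<comment> \<open>The minimizer of
    \<open>- (\<theta> * d) + \<theta>\<^sup>2 * \<beta>\<^sup>2 * T\<close>.\<close>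
  define \<theta> where "\<theta> = d / (2 * \<beta>\<^sup>2 * T)"
  \<comment> \<open>Capping the index keeps the whole sequence monotone and inside [0, T], as the
    maximal inequality demands.\<close>
  define r where "r k j = T * (real (min j (2 ^ k)) / 2 ^ k)" for k j
  define A where "A k = {\<omega> \<in> space M. \<exists>j\<le>2 ^ k. x + d < X (r k j) \<omega>}" for k
  have d: "0 < d" using b by (simp add: d_def)
  have \<theta>: "0 < \<theta>" using d \<beta> T by (simp add: \<theta>_def)
  have rT: "r k j \<in> {0..T}" for k j
  proof -
    have "real (min j (2 ^ k)) / 2 ^ k \<le> 1" by (simp add: min_def)
    then have "r k j \<le> T * 1" unfolding r_def using T by (intro mult_left_mono) auto
    then show ?thesis using T by (simp add: r_def)
  qed
  then have r01: "r k j \<in> {0..1}" for k j using T by (meson atLeastAtMost_iff order_trans)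
  have r_inc: "incseq (r k)" for k
    using T unfolding r_def by (intro monoI mult_left_mono divide_right_mono) auto
  note [measurable] = X[OF r01]
  have A_meas[measurable]: "A k \<in> events" for k unfolding A_def by measurable
  have A_bound: "prob (A k) \<le> exp (- ((b - x)\<^sup>2 / (16 * \<beta>\<^sup>2 * T)))" for k
  proof -
    have [measurable]: "J (r k j) \<in> borel_measurable M" for j
      using J r01 by (auto simp: has_ito_integral_def)
    \<comment> \<open>The exceptional null set depends on the time; countably many grid points share
      a common one.\<close>
    have "AE \<omega> in M. \<forall>j. X (r k j) \<omega> \<le> x + J (r k j) \<omega>"
      using X_le[OF r01] by (simp add: AE_all_countable)
    then have "AE \<omega> in M. \<omega> \<in> A k \<longrightarrow> \<omega> \<in> {\<omega> \<in> space M. \<exists>j\<le>2 ^ k. d < J (r k j) \<omega>}"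
    proof eventually_elim
      case (elim \<omega>)
      show ?case
      proof
        assume "\<omega> \<in> A k"
        then obtain j where "\<omega> \<in> space M" "j \<le> 2 ^ k" "x + d < X (r k j) \<omega>" by (auto simp: A_def)
        moreover have "X (r k j) \<omega> \<le> x + J (r k j) \<omega>" using elim by blast
        ultimately have "d < J (r k j) \<omega>" by linarith
        then show "\<omega> \<in> {\<omega> \<in> space M. \<exists>j\<le>2 ^ k. d < J (r k j) \<omega>}"
          using \<open>\<omega> \<in> space M\<close> \<open>j \<le> 2 ^ k\<close> by auto
      qed
    qed
    then have "prob (A k) \<le> prob {\<omega> \<in> space M. \<exists>j\<le>2 ^ k. d < J (r k j) \<omega>}"
      by (rule finite_measure_mono_AE) measurable
    also have "\<dots> \<le> exp (- (\<theta> * d) + \<theta>\<^sup>2 * \<beta>\<^sup>2 * T)"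
      by (rule ito_integral_maximal[OF J \<sigma> bound T(2) r_inc rT \<theta>])
    also have "- (\<theta> * d) + \<theta>\<^sup>2 * \<beta>\<^sup>2 * T = - ((b - x)\<^sup>2 / (16 * \<beta>\<^sup>2 * T))"
      using \<beta> T unfolding \<theta>_def d_def by (simp add: field_simps power2_eq_square)
    finally show ?thesis .
  qed
  have "A k \<subseteq> A (Suc k)" for k
  proof
    fix \<omega> assume "\<omega> \<in> A k"
    then obtain j where j: "\<omega> \<in> space M" "j \<le> 2 ^ k" "x + d < X (r k j) \<omega>" by (auto simp: A_def)
    moreover have "r (Suc k) (2 * j) = r k j" using j(2) by (simp add: r_def)
    ultimately show "\<omega> \<in> A (Suc k)" unfolding A_def by (intro CollectI conjI exI[of _ "2 * j"]) auto
  qed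
  then have "incseq A" by (rule incseq_SucI)
  then have "(\<lambda>k. prob (A k)) \<longlonglongrightarrow> prob (\<Union>k. A k)"
    by (intro finite_Lim_measure_incseq) auto
  then have "prob (\<Union>k. A k) \<le> exp (- ((b - x)\<^sup>2 / (16 * \<beta>\<^sup>2 * T)))"
    by (rule LIMSEQ_le_const2) (use A_bound in auto)
  moreover have "barrier_event M (\<lambda>t \<omega>. exp (X t \<omega>)) (exp b) T \<subseteq> (\<Union>k. A k)"
  proof
    fix \<omega> assume "\<omega> \<in> barrier_event M (\<lambda>t \<omega>. exp (X t \<omega>)) (exp b) T"
    then have \<omega>: "\<omega> \<in> space M" and ge: "exp b \<le> (SUP t\<in>{0..T}. exp (X t \<omega>))"
      by (auto simp: barrier_event_def)
    have co: "continuous_on {0..T} (\<lambda>t. X t \<omega>)"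
      using T by (intro continuous_on_subset[OF cont[OF \<omega>]]) auto
    obtain t where t: "t \<in> {0..T}" "\<And>u. u \<in> {0..T} \<Longrightarrow> X u \<omega> \<le> X t \<omega>"
      using continuous_attains_sup[OF _ _ co] T by (auto simp: compact_Icc)
    have "(SUP t\<in>{0..T}. exp (X t \<omega>)) \<le> exp (X t \<omega>)"
      using t T by (intro cSUP_least) auto
    then have "b \<le> X t \<omega>" using ge by (meson exp_le_cancel_iff order_trans)
    then have "x + d < X t \<omega>" using b by (simp add: d_def field_simps)
    from continuous_sup_gt_imp_dyadic_gt[OF T(1) co t(1) this]
    obtain k j where "j \<le> 2 ^ k" "x + d < X (T * (real j / 2 ^ k)) \<omega>" by auto
    then have "\<omega> \<in> A k" using \<omega> unfolding A_def r_def
      by (intro CollectI conjI exI[of _ j]) (simp_all add: min_absorb1)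
    then show "\<omega> \<in> (\<Union>k. A k)" by blast
  qed
  ultimately show ?thesis by (intro bexI[of _ "\<Union>k. A k"]) auto
qed

text \<open>The tail estimate with \<theta> = 3 decays faster than \<open>exp (2 * y)\<close> grows,
  so a sum over integer levels is a convergent geometric series.\<close>

lemma ito_integral_exp_moment:
  assumes J: "has_ito_integral M F Z \<sigma> J" and \<sigma>: "jointly_measurable M \<sigma>"
    and bound: "AE t in lborel. t \<in> {0..1} \<longrightarrow> (AE \<omega> in M. \<bar>\<sigma> t \<omega>\<bar> \<le> \<beta>)"
  shows "\<exists>C>0. \<forall>t\<in>{0..1}. (\<integral>\<^sup>+\<omega>. ennreal (exp (2 * J t \<omega>)) \<partial>M) \<le> ennreal C"
proof (intro exI conjI ballI)
  \<comment> \<open>Level n contributes at most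
    \<open>exp (2 * (n + 1)) * exp (- 3 * n + 9 * \<beta>\<^sup>2)\<close>, which is
    \<open>q * exp (- 1) ^ n\<close>.\<close>
  define q where "q = exp (2 + 9 * \<beta>\<^sup>2)"
  have sums: "(\<lambda>n. q * exp (- 1) ^ n) sums (q * (1 / (1 - exp (- 1))))"
    by (intro sums_mult geometric_sums) simp
  show "0 < 1 + q * (1 / (1 - exp (- 1)))"
    by (intro add_pos_nonneg) (auto simp: q_def)
  fix t :: real assume t: "t \<in> {0..1}"
  have [measurable]: "J t \<in> borel_measurable M" using J t by (auto simp: has_ito_integral_def)
  have tail: "prob {\<omega> \<in> space M. real n < J t \<omega>} \<le> exp (- (3 * real n) + 9 * \<beta>\<^sup>2)" for n
  proof -
    \<comment> \<open>The maximal inequality on the one-point grid at t, with horizon 1 so that the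
      bound is uniform in t.\<close>
    have "prob {\<omega> \<in> space M. \<exists>j\<le>0::nat. real n < J t \<omega>} \<le> exp (- (3 * real n) + 3\<^sup>2 * \<beta>\<^sup>2 * 1)"
      using t by (intro ito_integral_maximal[OF J \<sigma> bound]) (auto simp: incseq_def)
    then show ?thesis by simp
  qed
  have "ennreal (exp (2 * y)) \<le> 1 + (\<Sum>n. ennreal (exp (2 * (real n + 1))) * indicator {z. real n < z} y)" for y :: real
  proof (cases "0 < y")
    case True
    \<comment> \<open>Rounding up and subtracting 1 gives n < y, strictly even for integer y, so the
      indicator of level n is active.\<close>
    define n where "n = nat (\<lceil>y\<rceil> - 1)"
    have n: "real n < y" "y \<le> real n + 1" using True unfolding n_def by linarith+
    define g where "g n = ennreal (exp (2 * (real n + 1))) * indicator {z. real n < z} y" for n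
    have "ennreal (exp (2 * y)) \<le> g n"
      using n by (simp add: g_def ennreal_leI)
    also have "\<dots> \<le> (\<Sum>n. g n)"
      using sum_le_suminf[of g "{n}"] by simp
    also have "\<dots> \<le> 1 + \<dots>" by simp
    finally show ?thesis unfolding g_def .
  next
    case False
    then have "ennreal (exp (2 * y)) \<le> 1" by (simp add: ennreal_1[symmetric] del: ennreal_1)
    then show ?thesis by (rule order_trans) simp
  qed
  then have "(\<integral>\<^sup>+\<omega>. ennreal (exp (2 * J t \<omega>)) \<partial>M) \<le>
      (\<integral>\<^sup>+\<omega>. 1 + (\<Sum>n. ennreal (exp (2 * (real n + 1))) * indicator {z. real n < z} (J t \<omega>)) \<partial>M)"
    by (intro nn_integral_mono) auto
  also have "\<dots> = 1 + (\<Sum>n. \<integral>\<^sup>+\<omega>. ennreal (exp (2 * (real n + 1))) * indicator {z. real n < z} (J t \<omega>) \<partial>M)"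
    by (subst nn_integral_add) (auto simp: nn_integral_suminf emeasure_space_1)
  also have "(\<lambda>n. \<integral>\<^sup>+\<omega>. ennreal (exp (2 * (real n + 1))) * indicator {z. real n < z} (J t \<omega>) \<partial>M) =
      (\<lambda>n. ennreal (exp (2 * (real n + 1)) * prob {\<omega> \<in> space M. real n < J t \<omega>}))"
  proof
    fix n
    have "(\<integral>\<^sup>+\<omega>. ennreal (exp (2 * (real n + 1))) * indicator {z. real n < z} (J t \<omega>) \<partial>M) =
        (\<integral>\<^sup>+\<omega>. ennreal (exp (2 * (real n + 1))) * indicator {\<omega> \<in> space M. real n < J t \<omega>} \<omega> \<partial>M)"
      by (intro nn_integral_cong) (simp add: indicator_def)
    also have "\<dots> = ennreal (exp (2 * (real n + 1)) * prob {\<omega> \<in> space M. real n < J t \<omega>})"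
      by (simp add: nn_integral_cmult_indicator emeasure_eq_measure ennreal_mult)
    finally show "(\<integral>\<^sup>+\<omega>. ennreal (exp (2 * (real n + 1))) * indicator {z. real n < z} (J t \<omega>) \<partial>M) = \<dots>" .
  qed
  also have "1 + (\<Sum>n. ennreal (exp (2 * (real n + 1)) * prob {\<omega> \<in> space M. real n < J t \<omega>})) \<le>
     1 + (\<Sum>n. ennreal (q * exp (- 1) ^ n))"
  proof (intro add_left_mono suminf_le ennreal_leI)
    fix n
    have "exp (2 * (real n + 1)) * prob {\<omega> \<in> space M. real n < J t \<omega>} \<le>
        exp (2 * (real n + 1)) * exp (- (3 * real n) + 9 * \<beta>\<^sup>2)"
      by (intro mult_left_mono tail) simp
    also have "\<dots> = q * exp (- 1) ^ n"
      unfolding q_def exp_of_nat_mult[symmetric] exp_add[symmetric] by (simp add: algebra_simps)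
    finally show "exp (2 * (real n + 1)) * prob {\<omega> \<in> space M. real n < J t \<omega>} \<le> q * exp (- 1) ^ n" .
  qed auto
  also have "(\<Sum>n. ennreal (q * exp (- 1) ^ n)) = ennreal (q * (1 / (1 - exp (- 1))))"
    using sums by (intro suminf_ennreal_eq) (auto simp: q_def)
  also have "1 + ennreal (q * (1 / (1 - exp (- 1)))) = ennreal (1 + q * (1 / (1 - exp (- 1))))"
    by (subst ennreal_plus) (auto simp: q_def)
  finally show "(\<integral>\<^sup>+\<omega>. ennreal (exp (2 * J t \<omega>)) \<partial>M) \<le> ennreal (1 + q * (1 / (1 - exp (- 1))))" .
qed

end

section \<open>Gaussian tail integrals and the price estimate\<close>

lemma gaussian_tail_lower_bound:
  fixes b c x T :: real
  assumes c: "0 < c" and T: "0 < T" and b: "x < b"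
  shows "exp (- ((b - x)\<^sup>2 / (c * T))) \<le>
    (LBINT z:{b..}. exp (1 / c) / sqrt T * exp (- ((z - x)\<^sup>2 / (2 * c * T))))"
proof -
  define f where "f z = exp (1 / c) / sqrt T * exp (- ((z - x)\<^sup>2 / (2 * c * T)))" for z
  \<comment> \<open>The integrand decreases to the right of x, so over the window from b to b + sqrt
    T it is at least its value at the right end. The length of the window cancels the factor 1 /
    sqrt T.\<close>
  define v where "v = f (b + sqrt T)"
  have f_eq: "f z = exp (1 / c) / sqrt T * sqrt (2 * pi * (sqrt (c * T))\<^sup>2) * normal_density x (sqrt (c * T)) z" for z
    using c T by (simp add: f_def normal_density_def)
  have "integrable lborel f"
    unfolding f_eq[abs_def] using c T by (intro integrable_mult_right integrable_normal_density) simp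
  then have int: "integrable lborel (\<lambda>z. indicator {b..} z * f z)"
    using integrable_real_mult_indicator[of "{b..}" lborel f] by (simp add: mult.commute)
  have "exp (- ((b - x)\<^sup>2 / (c * T))) \<le> sqrt T * v"
  proof -
    \<comment> \<open>The factor 2 is absorbed by the 2 in the denominator of the exponent; the
      remaining 2 T costs 1 / c, which the prefactor \<open>exp (1 / c)\<close> repays.\<close>
    have "(b + sqrt T - x)\<^sup>2 \<le> 2 * (b - x)\<^sup>2 + 2 * T"
    proof -
      have "0 \<le> ((b - x) - sqrt T)\<^sup>2" by simp
      then show ?thesis using T by (simp add: power2_eq_square algebra_simps)
    qed
    then have "(b + sqrt T - x)\<^sup>2 / (2 * c * T) \<le> (2 * (b - x)\<^sup>2 + 2 * T) / (2 * c * T)"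
      using c T by (intro divide_right_mono) auto
    also have "\<dots> = (b - x)\<^sup>2 / (c * T) + 1 / c" using c T by (simp add: field_simps)
    finally have "exp (- ((b - x)\<^sup>2 / (c * T))) \<le> exp (1 / c + - ((b + sqrt T - x)\<^sup>2 / (2 * c * T)))" by simp
    also have "\<dots> = sqrt T * v" unfolding exp_add using T by (simp add: v_def f_def)
    finally show ?thesis .
  qed
  also have "\<dots> = (\<integral>z. indicator {b..b + sqrt T} z * v \<partial>lborel)" using T by simp
  also have "\<dots> \<le> (\<integral>z. indicator {b..} z * f z \<partial>lborel)"
  proof (rule integral_mono'[OF int])
    fix z
    show "0 \<le> indicator {b..} z * f z" using T by (simp add: f_def)
    show "indicator {b..b + sqrt T} z * v \<le> indicator {b..} z * f z"
    proof (cases "z \<in> {b..b + sqrt T}")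
      case True
      then have "(z - x)\<^sup>2 \<le> (b + sqrt T - x)\<^sup>2" using b by (intro power_mono) auto
      then have "(z - x)\<^sup>2 / (2 * c * T) \<le> (b + sqrt T - x)\<^sup>2 / (2 * c * T)"
        using c T by (intro divide_right_mono) auto
      then have "v \<le> f z" using T unfolding v_def f_def by (intro mult_left_mono) auto
      then show ?thesis using True by simp
    qed (use T in \<open>simp add: f_def\<close>)
  qed
  finally show ?thesis unfolding set_lebesgue_integral_def f_def real_scaleR_def .
qed

text \<open>Truncation at L: a positive y is at most L or else at most y^2 / L. The parameter L is
  left free, to be balanced against the probability of A.\<close>

lemma (in prob_space) barrier_call_price_le:
  assumes A: "A \<in> events" "barrier_event M (\<lambda>t \<omega>. exp (X t \<omega>)) H T \<subseteq> A"
    and X[measurable]: "X T \<in> borel_measurable M" and K: "0 \<le> K"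
    and C: "(\<integral>\<^sup>+\<omega>. ennreal (exp (2 * X T \<omega>)) \<partial>M) \<le> ennreal C" "0 \<le> C" and L: "0 < L"
  shows "barrier_call_price M (\<lambda>t \<omega>. exp (X t \<omega>)) K H T \<le> L * prob A + C / L"
proof -
  have int: "integrable M (\<lambda>\<omega>. exp (2 * X T \<omega>))"
    using C by (intro integrableI_nonneg) (auto intro: le_less_trans)
  have "ennreal (\<integral>\<omega>. exp (2 * X T \<omega>) \<partial>M) \<le> ennreal C"
    using C(1) nn_integral_eq_integral[OF int] by simp
  then have le: "(\<integral>\<omega>. exp (2 * X T \<omega>) \<partial>M) \<le> C" using C(2) by (simp add: ennreal_le_iff)
  have "barrier_call_price M (\<lambda>t \<omega>. exp (X t \<omega>)) K H T \<le>
      (\<integral>\<omega>. L * indicator A \<omega> + exp (2 * X T \<omega>) / L \<partial>M)"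
    unfolding barrier_call_price_def
  \<comment> \<open>Only the dominating function must be integrable: a non-integrable integrand has
    integral 0, and the dominating function is nonnegative. Hence measurability of the barrier event
    is not at issue.\<close>
  proof (rule integral_mono')
    show "integrable M (\<lambda>\<omega>. L * indicator A \<omega> + exp (2 * X T \<omega>) / L)"
      using int A(1) by (intro Bochner_Integration.integrable_add integrable_divide integrable_mult_right)
        (auto simp: emeasure_eq_measure)
    fix \<omega>
    show "0 \<le> L * indicator A \<omega> + exp (2 * X T \<omega>) / L" using L by simp
    show "max 0 (exp (X T \<omega>) - K) * indicator (barrier_event M (\<lambda>t \<omega>. exp (X t \<omega>)) H T) \<omega> \<le>
        L * indicator A \<omega> + exp (2 * X T \<omega>) / L"
    proof (cases "\<omega> \<in> barrier_event M (\<lambda>t \<omega>. exp (X t \<omega>)) H T")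
      case True
      have "max 0 (exp (X T \<omega>) - K) \<le> exp (X T \<omega>)" using K by simp
      also have "\<dots> \<le> L + exp (2 * X T \<omega>) / L"
      proof (cases "exp (X T \<omega>) \<le> L")
        case True
        moreover have "0 \<le> exp (2 * X T \<omega>) / L" using L by simp
        ultimately show ?thesis by linarith
      next
        case False
        then have "L * exp (X T \<omega>) \<le> exp (X T \<omega>) * exp (X T \<omega>)" by (intro mult_right_mono) auto
        also have "\<dots> = exp (2 * X T \<omega>)" by (simp add: exp_add[symmetric])
        finally have "exp (X T \<omega>) \<le> exp (2 * X T \<omega>) / L" using L by (simp add: field_simps)
        then show ?thesis using L by simp
      qed
      finally show ?thesis using True A(2) by (auto simp: indicator_def)
    qed (use L in simp)
  qed
  also have "\<dots> = L * prob A + (\<integral>\<omega>. exp (2 * X T \<omega>) \<partial>M) / L"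
    using int A(1) by (subst Bochner_Integration.integral_add) (auto simp: emeasure_eq_measure)
  also have "\<dots> \<le> L * prob A + C / L" using le L by (intro add_left_mono divide_right_mono) auto
  finally show ?thesis .
qed

lemma exp_neg_inverse_smallo_powr:
  fixes a m :: real
  assumes "0 < a" "0 < m"
  shows "(\<lambda>T. exp (- (a / T))) \<in> o[at_right 0](\<lambda>T. T powr m)"
  using assms by real_asymp

section \<open>The hitting bounds and the decay of the price\<close>

theorem theorem4p1:
  fixes M :: "'a measure"
    and W B Z \<sigma> J X S :: "real \<Rightarrow> 'a \<Rightarrow> real"
    and \<rho> x \<alpha> \<beta> Bstar b K :: real
  assumes "prob_space M"
    and "std_brownian_motion M W" and "std_brownian_motion M B"
    and "indep_processes M W B"
    and "-1 < \<rho>" and "\<rho> < 1"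
    and Z: "Z = (\<lambda>t \<omega>. \<rho> * W t \<omega> + sqrt (1 - \<rho>\<^sup>2) * B t \<omega>)"
    and "square_integrable_process M \<sigma>"
    and adapted: "\<forall>t\<in>{0..1}. \<sigma> t \<in> borel_measurable (generated_filtration M W t)"
    and "0 < \<alpha>" and "\<alpha> < \<beta>"
    and H1: "AE t in lborel. t \<in> {0..1} \<longrightarrow> (AE \<omega> in M. \<alpha> \<le> \<sigma> t \<omega> \<and> \<sigma> t \<omega> \<le> \<beta>)"
    and H2: "\<forall>p::real. p \<ge> 2 \<longrightarrow> \<sigma> \<in> sobolev_L1 M W p"
    and J: "has_ito_integral M (generated_filtration M (\<lambda>t \<omega>. (W t \<omega>, B t \<omega>))) Z \<sigma> J"
    and "\<forall>t\<in>{0..1}. X t \<in> borel_measurable M"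
    and X: "\<forall>t\<in>{0..1}. AE \<omega> in M.
              X t \<omega> = x - 1 / 2 * (LBINT s:{0..t}. (\<sigma> s \<omega>)\<^sup>2) + J t \<omega>"
    and "\<forall>\<omega>\<in>space M. continuous_on {0..1} (\<lambda>t. X t \<omega>)"
    and S: "S = (\<lambda>t \<omega>. exp (X t \<omega>))"
    and "Bstar > exp x" and "b = ln Bstar" and "K > 0"
  shows "(barrier_call_price M S K Bstar \<longlongrightarrow> 0) (at_right 0) \<and>
         (\<exists>T0 c1 c2 c3. 0 < T0 \<and> T0 \<le> 1 \<and> 0 < c1 \<and> 0 < c2 \<and> 0 < c3 \<and>
            (\<forall>T. 0 < T \<and> T \<le> T0 \<longrightarrow>
               measure M (barrier_event M S Bstar T)
                 \<le> min (exp (- ((b - x)\<^sup>2 / (c1 * T))))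
                       (LBINT z:{b..}. c2 / sqrt T * exp (- ((z - x)\<^sup>2 / (2 * c3 * T)))))) \<and>
         (\<forall>m::real. m > 0 \<longrightarrow>
            barrier_call_price M S K Bstar \<in> o[at_right 0](\<lambda>T. T powr m))"
proof -
  interpret prob_space M by fact
  have S': "S = (\<lambda>t \<omega>. exp (X t \<omega>))" by fact
  have "0 < Bstar" using \<open>Bstar > exp x\<close> exp_gt_zero less_trans by blast
  then have b: "exp b = Bstar" using \<open>b = ln Bstar\<close> by simp
  then have xb: "x < b" using \<open>Bstar > exp x\<close> by (metis exp_less_cancel_iff)
  have \<beta>: "0 < \<beta>" using \<open>0 < \<alpha>\<close> \<open>\<alpha> < \<beta>\<close> by simp
  define F where "F = generated_filtration M (\<lambda>t \<omega>. (W t \<omega>, B t \<omega>))"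
  interpret brownian_filtration M F Z
    unfolding F_def Z using assms(1-6) by (intro brownian_filtration_combination) auto
  have J': "has_ito_integral M F Z \<sigma> J" using J by (simp add: F_def)
  have \<sigma>: "jointly_measurable M \<sigma>"
    using \<open>square_integrable_process M \<sigma>\<close> by (simp add: square_integrable_process_def)
  have bound: "AE t in lborel. t \<in> {0..1} \<longrightarrow> (AE \<omega> in M. \<bar>\<sigma> t \<omega>\<bar> \<le> \<beta>)"
    using H1
  proof eventually_elim
    case (elim t)
    show ?case
    proof
      assume "t \<in> {0..1}"
      with elim have "AE \<omega> in M. \<alpha> \<le> \<sigma> t \<omega> \<and> \<sigma> t \<omega> \<le> \<beta>" by blast
      then show "AE \<omega> in M. \<bar>\<sigma> t \<omega>\<bar> \<le> \<beta>"
        by eventually_elim (use \<open>0 < \<alpha>\<close> in auto)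
    qed
  qed
  have X_meas: "X t \<in> borel_measurable M" if "t \<in> {0..1}" for t using assms that by blast
  have X_le: "AE \<omega> in M. X t \<omega> \<le> x + J t \<omega>" if "t \<in> {0..1}" for t
    using X[rule_format, OF that]
  proof eventually_elim
    case (elim \<omega>)
    \<comment> \<open>Nonnegative on every path, since a non-integrable function has integral 0; the
      drift can therefore be dropped.\<close>
    have "0 \<le> (LBINT s:{0..t}. (\<sigma> s \<omega>)\<^sup>2)"
      unfolding set_lebesgue_integral_def by (intro Bochner_Integration.integral_nonneg) (simp add: indicator_def)
    then show ?case using elim by simp
  qed
  have cont: "continuous_on {0..1} (\<lambda>t. X t \<omega>)" if "\<omega> \<in> space M" for \<omega> using assms that by blast
  define c where "c = 16 * \<beta>\<^sup>2"
  \<comment> \<open>Half the coefficient of 1 / T in the tail exponent, so that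
    \<open>exp (a / T)\<close> is the inverse square root of the tail bound.\<close>
  define a where "a = (b - x)\<^sup>2 / (2 * c)"
  have c: "0 < c" using \<beta> by (simp add: c_def)
  have a: "0 < a" using c xb by (simp add: a_def)
  have tail: "\<exists>A\<in>events. barrier_event M S Bstar T \<subseteq> A \<and> prob A \<le> exp (- ((b - x)\<^sup>2 / (c * T)))"
    if "0 < T" "T \<le> 1" for T
    using barrier_event_tail[OF J' \<sigma> bound \<beta> X_meas X_le cont that xb]
    unfolding S' b c_def by simp
  have "measure M (barrier_event M S Bstar T)
      \<le> min (exp (- ((b - x)\<^sup>2 / (c * T))))
            (LBINT z:{b..}. exp (1 / c) / sqrt T * exp (- ((z - x)\<^sup>2 / (2 * c * T))))"
    if T: "0 < T" "T \<le> 1" for T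
  proof -
    obtain A where A: "A \<in> events" "barrier_event M S Bstar T \<subseteq> A" "prob A \<le> exp (- ((b - x)\<^sup>2 / (c * T)))"
      using tail[OF T] by auto
    have "prob (barrier_event M S Bstar T) \<le> prob A" using A by (intro finite_measure_mono)
    then show ?thesis using A(3) gaussian_tail_lower_bound[OF c T(1) xb] by simp
  qed
  then have ii: "\<exists>T0 c1 c2 c3. 0 < T0 \<and> T0 \<le> 1 \<and> 0 < c1 \<and> 0 < c2 \<and> 0 < c3 \<and>
            (\<forall>T. 0 < T \<and> T \<le> T0 \<longrightarrow>
               measure M (barrier_event M S Bstar T)
                 \<le> min (exp (- ((b - x)\<^sup>2 / (c1 * T))))
                       (LBINT z:{b..}. c2 / sqrt T * exp (- ((z - x)\<^sup>2 / (2 * c3 * T)))))"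
    \<comment> \<open>The same c serves as c1 and c3, and T0 = 1 because the estimates hold on the
      whole time interval.\<close>
    using c by (intro exI[of _ 1] exI[of _ c] exI[of _ "exp (1 / c)"]) auto
  obtain C where C: "0 < C" "\<And>t. t \<in> {0..1} \<Longrightarrow> (\<integral>\<^sup>+\<omega>. ennreal (exp (2 * J t \<omega>)) \<partial>M) \<le> ennreal C"
    using ito_integral_exp_moment[OF J' \<sigma> bound] by blast
  have price: "\<bar>barrier_call_price M S K Bstar T\<bar> \<le> (1 + exp (2 * x) * C) * exp (- (a / T))"
    if T: "0 < T" "T \<le> 1" for T
  proof -
    obtain A where A: "A \<in> events" "barrier_event M S Bstar T \<subseteq> A" "prob A \<le> exp (- ((b - x)\<^sup>2 / (c * T)))"
      using tail[OF T] by auto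
    have [measurable]: "J T \<in> borel_measurable M" using J T by (auto simp: has_ito_integral_def)
    have "(\<integral>\<^sup>+\<omega>. ennreal (exp (2 * X T \<omega>)) \<partial>M) \<le> (\<integral>\<^sup>+\<omega>. ennreal (exp (2 * x)) * ennreal (exp (2 * J T \<omega>)) \<partial>M)"
    proof (rule nn_integral_mono_AE)
      have "AE \<omega> in M. X T \<omega> \<le> x + J T \<omega>" using T by (intro X_le) auto
      then show "AE \<omega> in M. ennreal (exp (2 * X T \<omega>)) \<le> ennreal (exp (2 * x)) * ennreal (exp (2 * J T \<omega>))"
        by eventually_elim (simp add: ennreal_mult[symmetric] exp_add[symmetric] ennreal_leI)
    qed
    also have "\<dots> = ennreal (exp (2 * x)) * (\<integral>\<^sup>+\<omega>. ennreal (exp (2 * J T \<omega>)) \<partial>M)"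
      by (rule nn_integral_cmult) simp
    also have "\<dots> \<le> ennreal (exp (2 * x)) * ennreal C"
      using T by (intro mult_left_mono C(2)) auto
    finally have moment: "(\<integral>\<^sup>+\<omega>. ennreal (exp (2 * X T \<omega>)) \<partial>M) \<le> ennreal (exp (2 * x) * C)"
      using C(1) by (simp add: ennreal_mult)
    \<comment> \<open>With L = \<open>exp (a / T)\<close> both terms become multiples of
      \<open>exp (- (a / T))\<close>.\<close>
    have "barrier_call_price M S K Bstar T \<le> exp (a / T) * prob A + exp (2 * x) * C / exp (a / T)"
      unfolding S' using A(1,2) T C(1) \<open>K > 0\<close> moment unfolding S'
      by (intro barrier_call_price_le X_meas) auto
    also have "\<dots> \<le> exp (a / T) * exp (- ((b - x)\<^sup>2 / (c * T))) + exp (2 * x) * C / exp (a / T)"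
      using A(3) by (intro add_right_mono mult_left_mono) auto
    also have "exp (a / T) * exp (- ((b - x)\<^sup>2 / (c * T))) = exp (- (a / T))"
      unfolding exp_add[symmetric] a_def using c T by (simp add: field_simps)
    finally have "barrier_call_price M S K Bstar T \<le> (1 + exp (2 * x) * C) * exp (- (a / T))"
      by (simp add: exp_minus field_simps)
    moreover have "0 \<le> barrier_call_price M S K Bstar T"
      unfolding barrier_call_price_def by (intro Bochner_Integration.integral_nonneg) (simp add: indicator_def)
    ultimately show ?thesis by simp
  qed
  have "\<forall>\<^sub>F T in at_right 0. T \<in> {0<..<1::real}"
    by (rule eventually_at_right_real) simp
  then have "\<forall>\<^sub>F T in at_right 0. norm (barrier_call_price M S K Bstar T) \<le>
      (1 + exp (2 * x) * C) * norm (exp (- (a / T)))"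
    by eventually_elim (use price in auto)
  then have "barrier_call_price M S K Bstar \<in> O[at_right 0](\<lambda>T. exp (- (a / T)))"
    by (rule bigoI)
  then have iii: "barrier_call_price M S K Bstar \<in> o[at_right 0](\<lambda>T. T powr m)" if "m > 0" for m
    by (rule landau_o.big_small_trans) (rule exp_neg_inverse_smallo_powr[OF a that])
  have "(barrier_call_price M S K Bstar \<longlongrightarrow> 0) (at_right 0)"
  proof -
    \<comment> \<open>The limit is the case m = 1 of the decay rate, weakened from o(T) to
      o(1).\<close>
    have "(\<lambda>T::real. T powr 1) \<in> O[at_right 0](\<lambda>_. 1)" by real_asymp
    then have "barrier_call_price M S K Bstar \<in> o[at_right 0](\<lambda>_. 1)"
      by (rule landau_o.small_big_trans[OF iii[OF zero_less_one]])
    from smalloD_tendsto[OF this] show ?thesis by simp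
  qed
  with ii iii show ?thesis by blast
qed

end
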